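(* Let $\tau\neq 0$ and $\delta\in\{1,-1\}$, and let $H_3(\tau)=(\mathbb{R}^3,g_\tau)$ be the Lorentzian Heisenberg group with $g_\tau=dx^2-\delta\,dy^2+\delta\,(dz+\tau(y\,dx-x\,dy))^2$. (A) Let $M$ be a constant angle surface immersed into $H_3(\tau)$. If $M$ is minimal, then $M$ is flat and, up to isometries of $H_3(\tau)$, it is (an open part of) one of the following "planes", where $\varphi_0$ is a real constant: (I) if $\delta=-1$, $M$ is timelike and it is parametrized by $F(u,v)=(\sin\varphi_0\, v,\,-\cos\varphi_0\, v,\,u)$; (II) if $\delta=1$, $M$ is either timelike or spacelike and it is parametrized by $F(u,v)=(\sinh\varphi_0\, v,\,\cosh\varphi_0\, v,\,u)$ in the timelike case, and by $F(u,v)=(\cosh\varphi_0\, v,\,\sinh\varphi_0\, v,\,u)$ in the spacelike case. (B) Moreover, $H_3(\tau)$ admits as proper CMC surfaces any open subset of the following flat (Riemannian or Lorentzian) "cylinders": (I) if $\delta=-1$, the timelike surface parametrized by $F(u,v)=(-\cos v,\,-\sin v,\,u-\tau v)$; (II) if $\delta=1$, the timelike surface parametrized by $F(u,v)=(\cosh v,\,\sinh v,\,u-\tau v)$ and the spacelike surface parametrized by $F(u,v)=(\sinh v,\,\cosh v,\,u+\tau v)$.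
   Context: Surfaces are oriented, with nondegenerate induced metric, and carry a unit normal vector field $N$ with $g_\tau(N,N)=\varepsilon\in\{1,-1\}$; $M$ is timelike if $\varepsilon=1$ and spacelike if $\varepsilon=-1$. Let $E_3=\partial_z$, so $g_\tau(E_3,E_3)=\delta$. The angle function of $M$ is $\nu=\varepsilon\, g_\tau(N,E_3)$; $M$ is a constant angle surface (helix surface) if $\nu$ is a real constant. The shape operator is $SX=-\nabla^\tau_X N$, where $\nabla^\tau$ is the Levi-Civita connection of $g_\tau$, and the mean curvature is $H=\frac12\mathrm{tr}\,S$. $M$ is minimal if $H=0$, CMC if $H$ is constant, and proper CMC if $H$ is a nonzero constant. Flat means that the Gaussian curvature of the induced metric is zero.
   Formalization: In (A) the surface M is assumed connected (and nonempty); without connectedness the claim fails, e.g. for the union of two disjoint parallel vertical planes, which is minimal with constant angle but is not part of a single plane. *)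

theory Defs
  imports "HOL-Analysis.Analysis"
begin

text \<open>Smoothness on an open set of a Euclidean space.\<close>

primrec Ck_on :: "nat \<Rightarrow> 'a::euclidean_space set \<Rightarrow> ('a \<Rightarrow> 'b::real_normed_vector) \<Rightarrow> bool" where
  "Ck_on 0 U f \<longleftrightarrow> continuous_on U f"
| "Ck_on (Suc k) U f \<longleftrightarrow> f differentiable_on U \<and>
     (\<forall>v. Ck_on k U (\<lambda>p. frechet_derivative f (at p) v))"

definition smooth_on :: "'a::euclidean_space set \<Rightarrow> ('a \<Rightarrow> 'b::real_normed_vector) \<Rightarrow> bool" where
  "smooth_on U f \<longleftrightarrow> (\<forall>k. Ck_on k U f)"

text \<open>A pseudo-Riemannian metric on an open subset of \<open>\<real>\<^sup>n\<close> is a function \<open>g\<close>, where \<open>g p v w\<close> is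
  the product at the point \<open>p\<close> of the tangent vectors \<open>v\<close> and \<open>w\<close>. Everything below is
  written in the standard coordinates.\<close>

type_synonym 'n metric = "real^'n \<Rightarrow> real^'n \<Rightarrow> real^'n \<Rightarrow> real"

definition metric_matrix :: "'n::finite metric \<Rightarrow> real^'n \<Rightarrow> real^'n^'n" where
  "metric_matrix g p = (\<chi> i j. g p (axis i 1) (axis j 1))"

definition partial :: "'n::finite \<Rightarrow> (real^'n \<Rightarrow> real) \<Rightarrow> real^'n \<Rightarrow> real" where
  "partial i h p = frechet_derivative h (at p) (axis i 1)"

text \<open>\<open>christoffel g p k i j\<close> is \<open>\<Gamma>\<^sup>k\<^sub>i\<^sub>j(p)\<close>, so that the Levi-Civita connection satisfies
  \<open>\<nabla>\<^sub>\<partial>\<^sub>i \<partial>\<^sub>j = \<Sum>k. \<Gamma>\<^sup>k\<^sub>i\<^sub>j \<partial>\<^sub>k\<close>.\<close>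

definition christoffel :: "'n::finite metric \<Rightarrow> real^'n \<Rightarrow> 'n \<Rightarrow> 'n \<Rightarrow> 'n \<Rightarrow> real" where
  "christoffel g p k i j = (\<Sum>l\<in>UNIV. 1/2 * matrix_inv (metric_matrix g p) $ k $ l *
     (partial i (\<lambda>q. metric_matrix g q $ j $ l) p
      + partial j (\<lambda>q. metric_matrix g q $ i $ l) p
      - partial l (\<lambda>q. metric_matrix g q $ i $ j) p))"

text \<open>\<open>riemann g p l i j k\<close> is the \<open>l\<close>-th component of
  \<open>R(\<partial>\<^sub>i,\<partial>\<^sub>j)\<partial>\<^sub>k = \<nabla>\<^sub>\<partial>\<^sub>i \<nabla>\<^sub>\<partial>\<^sub>j \<partial>\<^sub>k - \<nabla>\<^sub>\<partial>\<^sub>j \<nabla>\<^sub>\<partial>\<^sub>i \<partial>\<^sub>k\<close>.\<close>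

definition riemann :: "'n::finite metric \<Rightarrow> real^'n \<Rightarrow> 'n \<Rightarrow> 'n \<Rightarrow> 'n \<Rightarrow> 'n \<Rightarrow> real" where
  "riemann g p l i j k =
     partial i (\<lambda>q. christoffel g q l j k) p - partial j (\<lambda>q. christoffel g q l i k) p
     + (\<Sum>m\<in>UNIV. christoffel g p l i m * christoffel g p m j k
                 - christoffel g p l j m * christoffel g p m i k)"

text \<open>Gaussian curvature \<open>K = g(R(\<partial>\<^sub>1,\<partial>\<^sub>2)\<partial>\<^sub>2, \<partial>\<^sub>1) / (g\<^sub>1\<^sub>1 g\<^sub>2\<^sub>2 - g\<^sub>1\<^sub>2\<^sup>2)\<close>.\<close>

definition gaussian_curvature :: "2 metric \<Rightarrow> real^2 \<Rightarrow> real" where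
  "gaussian_curvature g p =
     (\<Sum>l\<in>UNIV. metric_matrix g p $ l $ 1 * riemann g p l 1 2 2) / det (metric_matrix g p)"

text \<open>Covariant derivative, in the direction \<open>v\<close> at the parameter value \<open>p\<close>, of a vector field
  \<open>N\<close> along the parametrized surface \<open>F\<close> in \<open>(\<real>\<^sup>3, g)\<close>.\<close>

definition covariant_derivative ::
  "3 metric \<Rightarrow> (real^2 \<Rightarrow> real^3) \<Rightarrow> (real^2 \<Rightarrow> real^3) \<Rightarrow> real^2 \<Rightarrow> real^2 \<Rightarrow> real^3" where
  "covariant_derivative g F N p v = frechet_derivative N (at p) v +
     (\<chi> k. \<Sum>i\<in>UNIV. \<Sum>j\<in>UNIV.
        christoffel g (F p) k i j * (frechet_derivative F (at p) v $ i) * (N p $ j))"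

definition induced_metric :: "3 metric \<Rightarrow> (real^2 \<Rightarrow> real^3) \<Rightarrow> 2 metric" where
  "induced_metric g F p v w =
     g (F p) (frechet_derivative F (at p) v) (frechet_derivative F (at p) w)"

text \<open>The shape operator \<open>S X = -\<nabla>\<^sub>X N\<close>, transported to the parameter plane by the
  injective differential of \<open>F\<close>.\<close>

definition shape_operator ::
  "3 metric \<Rightarrow> (real^2 \<Rightarrow> real^3) \<Rightarrow> (real^2 \<Rightarrow> real^3) \<Rightarrow> real^2 \<Rightarrow> real^2 \<Rightarrow> real^2" where
  "shape_operator g F N p v =
     (THE w. frechet_derivative F (at p) w = - covariant_derivative g F N p v)"

definition mean_curvature ::
  "3 metric \<Rightarrow> (real^2 \<Rightarrow> real^3) \<Rightarrow> (real^2 \<Rightarrow> real^3) \<Rightarrow> real^2 \<Rightarrow> real" where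
  "mean_curvature g F N p = 1/2 * trace (matrix (shape_operator g F N p))"

text \<open>An atlas of a surface is a set of pairs \<open>(U, \<phi>)\<close>, where \<open>\<phi>\<close> is a parametrization, defined
  on the open set \<open>U\<close> of the plane, of an open set of the surface (the inverse of a chart).
  Only the values of \<open>\<phi>\<close> on \<open>U\<close> matter.\<close>

type_synonym 'm atlas = "((real^2) set \<times> (real^2 \<Rightarrow> 'm)) set"

definition smooth_surface :: "'m topology \<Rightarrow> 'm atlas \<Rightarrow> bool" where
  "smooth_surface M A \<longleftrightarrow>
     Hausdorff_space M \<and> second_countable M \<and>
     (\<forall>(U, \<phi>)\<in>A. open U \<and> embedding_map (top_of_set U) M \<phi> \<and> openin M (\<phi> ` U)) \<and>
     (\<Union>(U, \<phi>)\<in>A. \<phi> ` U) = topspace M \<and>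
     (\<forall>(U, \<phi>)\<in>A. \<forall>(V, \<psi>)\<in>A. smooth_on {p\<in>U. \<phi> p \<in> \<psi> ` V} (inv_into V \<psi> \<circ> \<phi>))"

text \<open>The surface \<open>M\<close> immersed by \<open>f\<close> into \<open>(\<real>\<^sup>3, g)\<close>, with nondegenerate induced metric and a
  smooth unit normal \<open>N\<close>, \<open>g(N, N) = \<epsilon>\<close>. It is timelike if \<open>\<epsilon> = 1\<close> and spacelike
  if \<open>\<epsilon> = -1\<close>. The orientation of \<open>M\<close> is the one determined by \<open>N\<close>.\<close>

definition immersed_surface ::
  "3 metric \<Rightarrow> real \<Rightarrow> 'm topology \<Rightarrow> 'm atlas \<Rightarrow> ('m \<Rightarrow> real^3) \<Rightarrow> ('m \<Rightarrow> real^3) \<Rightarrow> bool" where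
  "immersed_surface g \<epsilon> M A f N \<longleftrightarrow>
     \<epsilon> \<in> {1, -1} \<and> smooth_surface M A \<and>
     (\<forall>(U, \<phi>)\<in>A. smooth_on U (f \<circ> \<phi>) \<and> smooth_on U (N \<circ> \<phi>) \<and>
        (\<forall>p\<in>U.
           inj (frechet_derivative (f \<circ> \<phi>) (at p)) \<and>
           (\<forall>v. (\<forall>w. induced_metric g (f \<circ> \<phi>) p v w = 0) \<longrightarrow> v = 0) \<and>
           (\<forall>v. g (f (\<phi> p)) (N (\<phi> p)) (frechet_derivative (f \<circ> \<phi>) (at p) v) = 0))) \<and>
     (\<forall>x\<in>topspace M. g (f x) (N x) (N x) = \<epsilon>)"

definition minimal_surface ::
  "3 metric \<Rightarrow> 'm atlas \<Rightarrow> ('m \<Rightarrow> real^3) \<Rightarrow> ('m \<Rightarrow> real^3) \<Rightarrow> bool" where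
  "minimal_surface g A f N \<longleftrightarrow>
     (\<forall>(U, \<phi>)\<in>A. \<forall>p\<in>U. mean_curvature g (f \<circ> \<phi>) (N \<circ> \<phi>) p = 0)"

definition proper_CMC_surface ::
  "3 metric \<Rightarrow> 'm atlas \<Rightarrow> ('m \<Rightarrow> real^3) \<Rightarrow> ('m \<Rightarrow> real^3) \<Rightarrow> bool" where
  "proper_CMC_surface g A f N \<longleftrightarrow>
     (\<exists>h. h \<noteq> 0 \<and> (\<forall>(U, \<phi>)\<in>A. \<forall>p\<in>U. mean_curvature g (f \<circ> \<phi>) (N \<circ> \<phi>) p = h))"

definition flat_surface :: "3 metric \<Rightarrow> 'm atlas \<Rightarrow> ('m \<Rightarrow> real^3) \<Rightarrow> bool" where
  "flat_surface g A f \<longleftrightarrow>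
     (\<forall>(U, \<phi>)\<in>A. \<forall>p\<in>U. gaussian_curvature (induced_metric g (f \<circ> \<phi>)) p = 0)"

definition is_isometry :: "3 metric \<Rightarrow> (real^3 \<Rightarrow> real^3) \<Rightarrow> bool" where
  "is_isometry g \<Phi> \<longleftrightarrow>
     bij \<Phi> \<and> smooth_on UNIV \<Phi> \<and> smooth_on UNIV (inv \<Phi>) \<and>
     (\<forall>p v w. g (\<Phi> p) (frechet_derivative \<Phi> (at p) v) (frechet_derivative \<Phi> (at p) w) = g p v w)"

text \<open>The metric \<open>g\<^sub>\<tau> = dx\<^sup>2 - \<delta> dy\<^sup>2 + \<delta> (dz + \<tau> (y dx - x dy))\<^sup>2\<close> of the Lorentzian
  Heisenberg group; \<open>heis_form\<close> is the 1-form \<open>dz + \<tau> (y dx - x dy)\<close>.\<close>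

definition heis_form :: "real \<Rightarrow> real^3 \<Rightarrow> real^3 \<Rightarrow> real" where
  "heis_form \<tau> p v = v $ 3 + \<tau> * (p $ 2 * v $ 1 - p $ 1 * v $ 2)"

definition heis :: "real \<Rightarrow> real \<Rightarrow> 3 metric" where
  "heis \<tau> \<delta> p v w = v $ 1 * w $ 1 - \<delta> * (v $ 2 * w $ 2) + \<delta> * (heis_form \<tau> p v * heis_form \<tau> p w)"

definition E3 :: "real^3" where
  "E3 = vector [0, 0, 1]"

definition constant_angle_surface ::
  "3 metric \<Rightarrow> real \<Rightarrow> 'm topology \<Rightarrow> ('m \<Rightarrow> real^3) \<Rightarrow> ('m \<Rightarrow> real^3) \<Rightarrow> bool" where
  "constant_angle_surface g \<epsilon> M f N \<longleftrightarrow> (\<exists>\<nu>. \<forall>x\<in>topspace M. \<epsilon> * g (f x) (N x) E3 = \<nu>)"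

text \<open>Up to an isometry, the immersed surface is an open part of the surface parametrized
  injectively by \<open>F\<close> on the whole plane.\<close>

definition open_part_up_to_isometry ::
  "3 metric \<Rightarrow> 'm topology \<Rightarrow> ('m \<Rightarrow> real^3) \<Rightarrow> (real^2 \<Rightarrow> real^3) \<Rightarrow> bool" where
  "open_part_up_to_isometry g M f F \<longleftrightarrow>
     (\<exists>\<Phi> W. is_isometry g \<Phi> \<and> open W \<and> (\<Phi> \<circ> f) ` topspace M = F ` W)"

text \<open>A subset \<open>S\<close> of \<open>\<real>\<^sup>3\<close> with the restrictions of \<open>F\<close> as parametrizations. The
  restrictions are needed because \<open>F\<close> may fail to be injective (circular cylinder).\<close>

definition restriction_atlas :: "(real^2 \<Rightarrow> real^3) \<Rightarrow> (real^3) set \<Rightarrow> (real^3) atlas" where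
  "restriction_atlas F S = {(W, F) | W. open W \<and> inj_on F W \<and> F ` W \<subseteq> S}"

text \<open>Every open subset \<open>S\<close> of the surface parametrized by \<open>F\<close> is, with the inclusion map,
  a flat proper CMC surface of causal type \<open>\<epsilon>\<close>.\<close>

definition open_subsets_flat_proper_CMC ::
  "3 metric \<Rightarrow> real \<Rightarrow> (real^2 \<Rightarrow> real^3) \<Rightarrow> bool" where
  "open_subsets_flat_proper_CMC g \<epsilon> F \<longleftrightarrow>
     (\<forall>S. openin (top_of_set (range F)) S \<longrightarrow>
        (\<exists>N. immersed_surface g \<epsilon> (top_of_set S) (restriction_atlas F S) id N \<and>
             flat_surface g (restriction_atlas F S) id \<and>
             proper_CMC_surface g (restriction_atlas F S) id N))"

end

theory Submission
  imports Defs
begin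

text \<open>
The proof is a computation with differential forms in the left-invariant frame
\<open>E\<^sub>1 = \<partial>\<^sub>x - \<tau> y \<partial>\<^sub>z\<close>, \<open>E\<^sub>2 = \<partial>\<^sub>y + \<tau> x \<partial>\<^sub>z\<close>, \<open>E\<^sub>3 = \<partial>\<^sub>z\<close>, whose dual coframe is \<open>dx\<close>, \<open>dy\<close> and the contact
form \<open>\<zeta> = dz + \<tau> (y dx - x dy)\<close> with \<open>d\<zeta> = - 2 \<tau> dx \<and> dy\<close>. Let \<open>(n1, n2, c)\<close> be the components of the unit
normal; the angle is constant if and only if \<open>c\<close> is. On the surface
\<open>n1 dx - \<delta> n2 dy + \<delta> c \<zeta> = 0\<close> and \<open>n1\<^sup>2 - \<delta> n2\<^sup>2 = \<epsilon> - \<delta> c\<^sup>2\<close>.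

\<^bold>\<open>A minimal constant angle surface is vertical, that is, \<open>c = 0\<close>.\<close> Suppose \<open>c \<noteq> 0\<close>. Then
\<open>dx \<and> dy\<close> has no zero on the surface. The exterior derivative of the first relation
(\<open>symmetric_shape\<close>) and the vanishing of the trace of the shape operator (\<open>transversal_minimal\<close>) are
\<open>dn1 \<and> dx - \<delta> dn2 \<and> dy = 2 \<tau> \<delta> c dx \<and> dy\<close> and \<open>dn1 \<and> dy + dx \<and> dn2 = 0\<close>. If \<open>\<epsilon> \<noteq> \<delta> c\<^sup>2\<close>, they determine the rotation of the normal:
\<open>n1 dn2 - n2 dn1 = - 2 \<tau> c (n1 dx - \<delta> n2 dy)\<close>, which is a multiple of \<open>\<zeta>\<close>. The left-hand side is closed,
because \<open>dn1\<close> and \<open>dn2\<close> are proportional, and \<open>\<zeta>\<close> is not: a contradiction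
(\<open>minimal_nonnull_imp_vertical\<close>). If \<open>\<epsilon> = \<delta> c\<^sup>2\<close>, the horizontal part of the normal is null and the two
equations contradict each other at every point (\<open>minimal_null_imp_vertical\<close>).

\<^bold>\<open>Vertical surfaces.\<close> For \<open>c = 0\<close> the surface is a cylinder over a plane curve. Then \<open>\<zeta>\<close> and the arc
length form of the curve are a closed coframe, which makes the surface flat (\<open>vertical_flat\<close>).
Minimality makes \<open>n1\<close> and \<open>n2\<close> locally constant (\<open>minimal_vertical_normal_constant\<close>). By connectedness
they are constant on the surface, and so is \<open>n1 x - \<delta> n2 y\<close>: the surface lies in a vertical plane, which a
left translation moves to the origin, and it is open in the plane by the open mapping theorem
(\<open>vertical_plane_open_part\<close>). Writing \<open>(n1, n2)\<close> by means of an angle gives the three normal forms; for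
\<open>\<delta> = -1\<close> the relation \<open>n1\<^sup>2 + n2\<^sup>2 = \<epsilon>\<close> forces \<open>\<epsilon> = 1\<close>.

\<^bold>\<open>Proper CMC cylinders.\<close> The base curves \<open>(a, b)\<close> are the unit circle and the unit hyperbolas,
for which \<open>a' = \<delta> b\<close> and \<open>b' = a\<close>. The normal is the horizontal lift of the position vector, with
\<open>n1 = x\<close> and \<open>n2 = y\<close>. Hence \<open>dn1 = dx\<close> and \<open>dn2 = dy\<close>, and the formula for the mean curvature of a vertical
surface yields \<open>H = - 1/2\<close> (\<open>mean_curvature_F\<close>); flatness is again \<open>vertical_flat\<close>.
\<close>

section \<open>Smooth functions and mixed partial derivatives\<close>

lemma has_derivative_cong_open:
  assumes "open U" "p \<in> U" and "\<And>q. q \<in> U \<Longrightarrow> f q = g q"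
  shows "(f has_derivative f') (at p) \<longleftrightarrow> (g has_derivative f') (at p)"
  using has_derivative_transform_within_open[OF _ assms(1,2)] assms(3) by metis

text \<open>The two functions have the same derivatives at the point, if any, so the choice operator in the
definition of \<open>frechet_derivative\<close> picks the same map for both.\<close>

lemma frechet_derivative_cong_open:
  assumes "open U" "p \<in> U" and "\<And>q. q \<in> U \<Longrightarrow> f q = g q"
  shows "frechet_derivative f (at p) = frechet_derivative g (at p)"
  unfolding frechet_derivative_def using has_derivative_cong_open[OF assms] by presburger

lemma differentiable_on_openI:
  assumes "open U" and "\<And>p. p \<in> U \<Longrightarrow> (f has_derivative f' p) (at p)"
  shows "f differentiable_on U"
  using assms differentiable_on_eq_differentiable_at differentiableI by metis

lemma differentiable_on_openD:
  assumes "f differentiable_on U" "open U" "p \<in> U"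
  shows "(f has_derivative frechet_derivative f (at p)) (at p)"
  using assms differentiable_on_eq_differentiable_at frechet_derivative_works by metis

lemma Ck_on_cong:
  fixes f g :: "'a::euclidean_space \<Rightarrow> 'b::real_normed_vector"
  assumes U: "open U" and "\<And>p. p \<in> U \<Longrightarrow> f p = g p"
  shows "Ck_on k U f \<longleftrightarrow> Ck_on k U g"
  using assms(2)
proof (induction k arbitrary: f g)
  case 0
  then show ?case by (simp cong: continuous_on_cong)
next
  case (Suc k)
  have "(f has_derivative f') (at p) \<longleftrightarrow> (g has_derivative f') (at p)" if "p \<in> U" for p f'
    using has_derivative_cong_open[OF U that Suc.prems] .
  then have "f differentiable_on U \<longleftrightarrow> g differentiable_on U"
    by (simp add: differentiable_on_eq_differentiable_at[OF U] differentiable_def)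
  moreover have "frechet_derivative f (at p) v = frechet_derivative g (at p) v" if "p \<in> U" for p v
    using frechet_derivative_cong_open[OF U that Suc.prems] by simp
  ultimately show ?case
    using Suc.IH by (metis (no_types, lifting) Ck_on.simps(2))
qed

lemma Ck_on_Suc_imp:
  fixes f :: "'a::euclidean_space \<Rightarrow> 'b::real_normed_vector"
  assumes "Ck_on (Suc k) U f"
  shows "Ck_on k U f"
  using assms
proof (induction k arbitrary: f)
  case 0
  then show ?case by (simp add: differentiable_imp_continuous_on)
next
  case (Suc k)
  then show ?case by (metis Ck_on.simps(2))
qed

lemma smooth_on_differentiable:
  assumes "smooth_on U f" "open U" "p \<in> U"
  shows "f differentiable (at p)"
  using assms differentiable_on_eq_differentiable_at
  by (metis Ck_on.simps(2) smooth_on_def)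

lemma smooth_on_frechet_derivative:
  assumes "smooth_on U f"
  shows "smooth_on U (\<lambda>p. frechet_derivative f (at p) v)"
  using assms unfolding smooth_on_def by (metis Ck_on.simps(2))

lemma smooth_on_continuous_on: "smooth_on U f \<Longrightarrow> continuous_on U f"
  unfolding smooth_on_def by (metis Ck_on.simps(1))

lemma Ck_on_const: "Ck_on k U (\<lambda>p. c)"
  by (induction k arbitrary: c) (auto simp: frechet_derivative_const)

lemma Ck_on_bounded_linear:
  fixes f :: "'a::euclidean_space \<Rightarrow> 'b::real_normed_vector"
  assumes L: "bounded_linear L" and U: "open U"
  shows "Ck_on k U f \<Longrightarrow> Ck_on k U (\<lambda>p. L (f p))"
proof (induction k arbitrary: f)
  case 0
  then show ?case using bounded_linear.continuous_on[OF L] by auto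
next
  case (Suc k)
  have d: "((\<lambda>p. L (f p)) has_derivative (\<lambda>v. L (frechet_derivative f (at p) v))) (at p)"
    if "p \<in> U" for p
    using Suc.prems that differentiable_on_openD[OF _ U]
    by (intro bounded_linear.has_derivative[OF L]) auto
  then have "frechet_derivative (\<lambda>p. L (f p)) (at p) v = L (frechet_derivative f (at p) v)"
    if "p \<in> U" for p v
    using frechet_derivative_at[OF d[OF that]] by metis
  then have "Ck_on k U (\<lambda>p. frechet_derivative (\<lambda>p. L (f p)) (at p) v)" for v
    using Suc Ck_on_cong[OF U, of "\<lambda>p. frechet_derivative (\<lambda>p. L (f p)) (at p) v"
        "\<lambda>p. L (frechet_derivative f (at p) v)"] by auto
  then show ?case
    using differentiable_on_openI[OF U d] by simp
qed

lemma smooth_on_component: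
  fixes f :: "'a::euclidean_space \<Rightarrow> real^'n"
  assumes "smooth_on U f" "open U"
  shows "smooth_on U (\<lambda>p. f p $ i)"
  using assms Ck_on_bounded_linear[OF bounded_linear_vec_nth]
  unfolding smooth_on_def by blast

lemma Ck_on_add:
  fixes f g :: "'a::euclidean_space \<Rightarrow> 'b::real_normed_vector"
  assumes U: "open U"
  shows "Ck_on k U f \<Longrightarrow> Ck_on k U g \<Longrightarrow> Ck_on k U (\<lambda>p. f p + g p)"
proof (induction k arbitrary: f g)
  case 0
  then show ?case by (auto intro: continuous_on_add)
next
  case (Suc k)
  have d: "((\<lambda>p. f p + g p) has_derivative
      (\<lambda>v. frechet_derivative f (at p) v + frechet_derivative g (at p) v)) (at p)"
    if "p \<in> U" for p
    using Suc.prems that differentiable_on_openD[OF _ U]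
    by (intro has_derivative_add) auto
  then have "frechet_derivative (\<lambda>p. f p + g p) (at p) v
      = frechet_derivative f (at p) v + frechet_derivative g (at p) v"
    if "p \<in> U" for p v
    using frechet_derivative_at[OF d[OF that]] by metis
  then have "Ck_on k U (\<lambda>p. frechet_derivative (\<lambda>p. f p + g p) (at p) v)" for v
    using Suc Ck_on_cong[OF U, of "\<lambda>p. frechet_derivative (\<lambda>p. f p + g p) (at p) v"
        "\<lambda>p. frechet_derivative f (at p) v + frechet_derivative g (at p) v"] by auto
  then show ?case
    using differentiable_on_openI[OF U d] by simp
qed

lemma Ck_on_mult:
  fixes f g :: "'a::euclidean_space \<Rightarrow> real"
  assumes U: "open U"
  shows "Ck_on k U f \<Longrightarrow> Ck_on k U g \<Longrightarrow> Ck_on k U (\<lambda>p. f p * g p)"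
proof (induction k arbitrary: f g)
  case 0
  then show ?case by (auto intro: continuous_on_mult)
next
  case (Suc k)
  have d: "((\<lambda>p. f p * g p) has_derivative
      (\<lambda>v. f p * frechet_derivative g (at p) v + frechet_derivative f (at p) v * g p)) (at p)"
    if "p \<in> U" for p
    using Suc.prems that differentiable_on_openD[OF _ U]
    by (intro has_derivative_mult) auto
  then have "frechet_derivative (\<lambda>p. f p * g p) (at p) v
      = f p * frechet_derivative g (at p) v + frechet_derivative f (at p) v * g p"
    if "p \<in> U" for p v
    using frechet_derivative_at[OF d[OF that]] by metis
  moreover have "Ck_on k U (\<lambda>p. f p * frechet_derivative g (at p) v
      + frechet_derivative f (at p) v * g p)" for v
    using Suc.prems Ck_on_Suc_imp[of k U f] Ck_on_Suc_imp[of k U g]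
    by (intro Ck_on_add[OF U] Suc.IH) auto
  ultimately have "Ck_on k U (\<lambda>p. frechet_derivative (\<lambda>p. f p * g p) (at p) v)" for v
    using Ck_on_cong[OF U, of "\<lambda>p. frechet_derivative (\<lambda>p. f p * g p) (at p) v"
        "\<lambda>p. f p * frechet_derivative g (at p) v + frechet_derivative f (at p) v * g p"] by auto
  then show ?case
    using differentiable_on_openI[OF U d] by simp
qed

lemma smooth_on_const: "smooth_on U (\<lambda>p. c)"
  by (simp add: smooth_on_def Ck_on_const)

lemma smooth_on_add:
  assumes "open U" "smooth_on U f" "smooth_on U g"
  shows "smooth_on U (\<lambda>p. f p + g p)"
  using assms Ck_on_add unfolding smooth_on_def by blast

lemma smooth_on_mult:
  fixes f g :: "'a::euclidean_space \<Rightarrow> real"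
  assumes "open U" "smooth_on U f" "smooth_on U g"
  shows "smooth_on U (\<lambda>p. f p * g p)"
  using assms Ck_on_mult unfolding smooth_on_def by blast

lemma smooth_on_diff:
  fixes f g :: "'a::euclidean_space \<Rightarrow> real"
  assumes "open U" "smooth_on U f" "smooth_on U g"
  shows "smooth_on U (\<lambda>p. f p - g p)"
  using smooth_on_add[OF assms(1,2) smooth_on_mult[OF assms(1) smooth_on_const[of U "-1"] assms(3)]]
  by simp

text \<open>Affine maps and, locally, transition maps between charts that differ by a translation have this
form, so their smoothness needs no computation of higher derivatives.\<close>

lemma smooth_on_constant_derivative:
  assumes U: "open U" and d: "\<And>p. p \<in> U \<Longrightarrow> (f has_derivative L) (at p)"
  shows "smooth_on U f"
  unfolding smooth_on_def
proof
  fix k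
  have diff: "f differentiable_on U"
    using differentiable_on_openI[OF U d] by simp
  show "Ck_on k U f"
  proof (cases k)
    case 0
    then show ?thesis using diff by (simp add: differentiable_imp_continuous_on)
  next
    case (Suc j)
    have "frechet_derivative f (at p) v = L v" if "p \<in> U" for p v
      using frechet_derivative_at[OF d[OF that]] by metis
    then have "Ck_on j U (\<lambda>p. frechet_derivative f (at p) v)" for v
      using Ck_on_cong[OF U, of "\<lambda>p. frechet_derivative f (at p) v" "\<lambda>p. L v"] Ck_on_const
      by blast
    then show ?thesis using diff Suc by simp
  qed
qed

lemma has_real_derivative_along_line:
  fixes h :: "'a::euclidean_space \<Rightarrow> real"
  assumes "smooth_on U h" "open U" "w + a *\<^sub>R u \<in> U"
  shows "((\<lambda>s. h (w + s *\<^sub>R u)) has_real_derivative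
      frechet_derivative h (at (w + a *\<^sub>R u)) u) (at a)"
proof -
  have hd: "(h has_derivative frechet_derivative h (at (w + a *\<^sub>R u))) (at (w + a *\<^sub>R u))"
    using smooth_on_differentiable[OF assms] by (simp add: frechet_derivative_works)
  have "((\<lambda>s. h (w + s *\<^sub>R u)) has_derivative
      (\<lambda>r. frechet_derivative h (at (w + a *\<^sub>R u)) (r *\<^sub>R u))) (at a)"
    by (rule has_derivative_compose[where f = "\<lambda>s. w + s *\<^sub>R u", OF _ hd])
       (auto intro!: derivative_eq_intros)
  moreover have "(\<lambda>r. frechet_derivative h (at (w + a *\<^sub>R u)) (r *\<^sub>R u))
      = (*) (frechet_derivative h (at (w + a *\<^sub>R u)) u)"
    using linear_scale[OF has_derivative_linear[OF hd]] by (auto simp: mult.commute)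
  ultimately show ?thesis by (simp add: has_field_derivative_def)
qed

text \<open>The mean value theorem, used along \<open>u\<close> and then along \<open>v\<close>, turns the second difference over a
parallelogram into a mixed second derivative at an inner point. The second difference is symmetric
in \<open>u\<close> and \<open>v\<close>, which is why mixed derivatives commute.\<close>

lemma second_difference_mean_value:
  fixes h :: "'a::euclidean_space \<Rightarrow> real"
  assumes h: "smooth_on U h" and U: "open U" and t: "0 < t"
    and box: "\<And>a b. 0 \<le> a \<Longrightarrow> a \<le> t \<Longrightarrow> 0 \<le> b \<Longrightarrow> b \<le> t \<Longrightarrow> p + a *\<^sub>R u + b *\<^sub>R v \<in> U"
  obtains a b where "0 < a" "a < t" "0 < b" "b < t"
    "h (p + t *\<^sub>R u + t *\<^sub>R v) - h (p + t *\<^sub>R u) - h (p + t *\<^sub>R v) + h p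
      = t * t * frechet_derivative (\<lambda>q. frechet_derivative h (at q) u)
                  (at (p + a *\<^sub>R u + b *\<^sub>R v)) v"
proof -
  define D where "D q = frechet_derivative h (at q) u" for q
  have D: "smooth_on U D"
    unfolding D_def using h by (rule smooth_on_frechet_derivative)
  have lineu: "((\<lambda>s. h (w + s *\<^sub>R u)) has_real_derivative D (w + a *\<^sub>R u)) (at a)"
    if "w + a *\<^sub>R u \<in> U" for w a
    using has_real_derivative_along_line[OF h U that] by (simp add: D_def)
  note linev = has_real_derivative_along_line[OF D U]
  have "\<exists>a. 0 < a \<and> a < t \<and>
      (h ((p + t *\<^sub>R v) + t *\<^sub>R u) - h (p + t *\<^sub>R u))
       - (h ((p + t *\<^sub>R v) + 0 *\<^sub>R u) - h (p + 0 *\<^sub>R u))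
      = (t - 0) * (D ((p + t *\<^sub>R v) + a *\<^sub>R u) - D (p + a *\<^sub>R u))"
  proof (rule MVT2[OF t])
    fix s assume s: "0 \<le> s" "s \<le> t"
    have "(p + t *\<^sub>R v) + s *\<^sub>R u \<in> U" "p + s *\<^sub>R u \<in> U"
      using box[of s t] box[of s 0] s t by (simp_all add: algebra_simps)
    then show "((\<lambda>s. h ((p + t *\<^sub>R v) + s *\<^sub>R u) - h (p + s *\<^sub>R u)) has_real_derivative
        (D ((p + t *\<^sub>R v) + s *\<^sub>R u) - D (p + s *\<^sub>R u))) (at s)"
      by (intro DERIV_diff lineu)
  qed
  then obtain a where a: "0 < a" "a < t" and ha:
      "h (p + t *\<^sub>R v + t *\<^sub>R u) - h (p + t *\<^sub>R u) - (h (p + t *\<^sub>R v) - h p)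
      = t * (D (p + t *\<^sub>R v + a *\<^sub>R u) - D (p + a *\<^sub>R u))"
    by auto
  have "\<exists>b. 0 < b \<and> b < t \<and> D ((p + a *\<^sub>R u) + t *\<^sub>R v) - D ((p + a *\<^sub>R u) + 0 *\<^sub>R v)
      = (t - 0) * frechet_derivative D (at ((p + a *\<^sub>R u) + b *\<^sub>R v)) v"
    by (rule MVT2[OF t]) (use box a in \<open>auto intro!: linev\<close>)
  then obtain b where b: "0 < b" "b < t" and hb:
      "D (p + a *\<^sub>R u + t *\<^sub>R v) - D (p + a *\<^sub>R u)
      = t * frechet_derivative D (at (p + a *\<^sub>R u + b *\<^sub>R v)) v"
    by auto
  have "D (p + t *\<^sub>R v + a *\<^sub>R u) = D (p + a *\<^sub>R u + t *\<^sub>R v)"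
    "h (p + t *\<^sub>R v + t *\<^sub>R u) = h (p + t *\<^sub>R u + t *\<^sub>R v)"
    by (simp_all add: algebra_simps)
  then show ?thesis
    using that[OF a b] ha hb unfolding D_def[symmetric] by (simp add: algebra_simps)
qed

text \<open>Both mixed derivatives at \<open>p\<close> are limits of the same second difference divided by \<open>t * t\<close>, because
the second derivatives are continuous.\<close>

lemma frechet_derivative_commute:
  fixes h :: "'a::euclidean_space \<Rightarrow> real"
  assumes h: "smooth_on U h" and U: "open U" and p: "p \<in> U"
  shows "frechet_derivative (\<lambda>q. frechet_derivative h (at q) u) (at p) v
       = frechet_derivative (\<lambda>q. frechet_derivative h (at q) v) (at p) u"
proof -
  define A where "A q = frechet_derivative (\<lambda>q. frechet_derivative h (at q) u) (at q) v" for q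
  define B where "B q = frechet_derivative (\<lambda>q. frechet_derivative h (at q) v) (at q) u" for q
  have "continuous_on U A" "continuous_on U B"
    unfolding A_def B_def by (intro smooth_on_continuous_on smooth_on_frechet_derivative h)+
  then have cA: "continuous (at p) A" and cB: "continuous (at p) B"
    using U p continuous_on_eq_continuous_at by blast+
  have "\<bar>A p - B p\<bar> < e" if e: "e > 0" for e
  proof -
    from cA e obtain d1 where d1: "d1 > 0" "\<And>q. dist q p < d1 \<Longrightarrow> \<bar>A q - A p\<bar> < e/2"
      unfolding continuous_at_eps_delta dist_real_def by (meson half_gt_zero)
    from cB e obtain d2 where d2: "d2 > 0" "\<And>q. dist q p < d2 \<Longrightarrow> \<bar>B q - B p\<bar> < e/2"
      unfolding continuous_at_eps_delta dist_real_def by (meson half_gt_zero)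
    obtain d3 where d3: "d3 > 0" "ball p d3 \<subseteq> U" using U p open_contains_ball by blast
    define d where "d = min d1 (min d2 d3)"
    have d: "d > 0" "d \<le> d1" "d \<le> d2" "d \<le> d3" using d1 d2 d3 by (auto simp: d_def)
    \<comment> \<open>the parallelogram with sides \<open>t u\<close> and \<open>t v\<close> fits into the ball of radius \<open>d\<close>\<close>
    define t where "t = d / (2 * (norm u + norm v + 1))"
    have den: "norm u + norm v + 1 > 0" by (smt (verit) norm_ge_zero)
    have t: "t > 0" using d den by (simp add: t_def)
    have tb: "t * (norm u + norm v) < d"
    proof -
      have "t * (norm u + norm v) \<le> t * (norm u + norm v + 1)" using t by simp
      also have "\<dots> = d / 2" using den by (simp add: t_def field_simps)
      also have "\<dots> < d" using d by simp
      finally show ?thesis .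
    qed
    have near: "dist (p + a *\<^sub>R x + b *\<^sub>R y) p < d"
      if "0 \<le> a" "a \<le> t" "0 \<le> b" "b \<le> t" "norm x + norm y = norm u + norm v" for a b x y
    proof -
      have "dist (p + a *\<^sub>R x + b *\<^sub>R y) p = norm (a *\<^sub>R x + b *\<^sub>R y)"
        by (simp add: dist_norm algebra_simps)
      also have "\<dots> \<le> a * norm x + b * norm y"
        using that norm_triangle_ineq[of "a *\<^sub>R x" "b *\<^sub>R y"] by simp
      also have "\<dots> \<le> t * norm x + t * norm y"
        using that by (intro add_mono mult_right_mono) auto
      also have "\<dots> = t * (norm u + norm v)" using that by (metis distrib_left)
      finally show ?thesis using tb by simp
    qed
    have inU: "p + a *\<^sub>R x + b *\<^sub>R y \<in> U"
      if "0 \<le> a" "a \<le> t" "0 \<le> b" "b \<le> t" "norm x + norm y = norm u + norm v" for a b x y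
      using near[OF that] d d3 by (auto simp: dist_commute)
    obtain a b where ab: "0 < a" "a < t" "0 < b" "b < t"
      "h (p + t *\<^sub>R u + t *\<^sub>R v) - h (p + t *\<^sub>R u) - h (p + t *\<^sub>R v) + h p
      = t * t * A (p + a *\<^sub>R u + b *\<^sub>R v)"
      using second_difference_mean_value[OF h U t, of p u v] inU[of _ _ u v] unfolding A_def by metis
    obtain a' b' where ab': "0 < a'" "a' < t" "0 < b'" "b' < t"
      "h (p + t *\<^sub>R v + t *\<^sub>R u) - h (p + t *\<^sub>R v) - h (p + t *\<^sub>R u) + h p
      = t * t * B (p + a' *\<^sub>R v + b' *\<^sub>R u)"
      using second_difference_mean_value[OF h U t, of p v u] inU[of _ _ v u] unfolding B_def
      by (metis add.commute)
    have "h (p + t *\<^sub>R v + t *\<^sub>R u) = h (p + t *\<^sub>R u + t *\<^sub>R v)" by (simp add: algebra_simps)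
    then have "t * t * A (p + a *\<^sub>R u + b *\<^sub>R v) = t * t * B (p + a' *\<^sub>R v + b' *\<^sub>R u)"
      using ab ab' by linarith
    then have "A (p + a *\<^sub>R u + b *\<^sub>R v) = B (p + a' *\<^sub>R v + b' *\<^sub>R u)" using t by simp
    moreover have "\<bar>A (p + a *\<^sub>R u + b *\<^sub>R v) - A p\<bar> < e/2"
      using near[of a b u v] ab d by (intro d1) auto
    moreover have "\<bar>B (p + a' *\<^sub>R v + b' *\<^sub>R u) - B p\<bar> < e/2"
      using near[of a' b' v u] ab' d by (intro d2) auto
    ultimately show ?thesis by linarith
  qed
  then have "A p = B p" by (metis abs_0 less_irrefl zero_less_abs_iff eq_iff_diff_eq_0 abs_abs)
  then show ?thesis by (simp add: A_def B_def)
qed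

lemma smooth_on_partial: "smooth_on U h \<Longrightarrow> smooth_on U (partial i h)"
  using smooth_on_frechet_derivative by (auto simp: partial_def[abs_def])

lemma partial_commute:
  assumes "smooth_on U h" "open U" "p \<in> U"
  shows "partial i (partial j h) p = partial j (partial i h) p"
  using frechet_derivative_commute[OF assms, of "axis j 1" "axis i 1"]
  by (simp add: partial_def[abs_def])

lemma partial_cong:
  assumes "open U" "p \<in> U" "\<And>q. q \<in> U \<Longrightarrow> f q = g q"
  shows "partial i f p = partial i g p"
  unfolding partial_def using frechet_derivative_cong_open[OF assms] by simp

lemma has_derivative_partial:
  assumes "(h has_derivative h') (at p)"
  shows "partial i h p = h' (axis i 1)"
  using frechet_derivative_at[OF assms] by (simp add: partial_def)

lemma partial_const: "partial i (\<lambda>q. c) p = 0"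
  by (simp add: partial_def frechet_derivative_const)

lemma partial_add:
  assumes "f differentiable at p" "g differentiable at p"
  shows "partial i (\<lambda>q. f q + g q) p = partial i f p + partial i g p"
  using has_derivative_partial[OF has_derivative_add] assms
  unfolding frechet_derivative_works partial_def by blast

lemma partial_diff:
  assumes "f differentiable at p" "g differentiable at p"
  shows "partial i (\<lambda>q. f q - g q) p = partial i f p - partial i g p"
  using has_derivative_partial[OF has_derivative_diff] assms
  unfolding frechet_derivative_works partial_def by blast

lemma partial_mult:
  assumes "f differentiable at p" "g differentiable at p"
  shows "partial i (\<lambda>q. f q * g q) p = f p * partial i g p + partial i f p * g p"
  using has_derivative_partial[OF has_derivative_mult] assms
  unfolding frechet_derivative_works partial_def by blast

lemma frechet_derivative_eq_partials:
  fixes h :: "real^2 \<Rightarrow> real"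
  assumes "h differentiable at p"
  shows "frechet_derivative h (at p) v = v $ 1 * partial 1 h p + v $ 2 * partial 2 h p"
proof -
  have lin: "linear (frechet_derivative h (at p))"
    using assms by (rule linear_frechet_derivative)
  have "v = v $ 1 *\<^sub>R axis 1 1 + v $ 2 *\<^sub>R axis 2 1"
    by (simp add: vec_eq_iff forall_2 axis_def)
  then have "frechet_derivative h (at p) v
      = frechet_derivative h (at p) (v $ 1 *\<^sub>R axis 1 1 + v $ 2 *\<^sub>R axis 2 1)" by simp
  then show ?thesis
    by (simp only: linear_add[OF lin] linear_scale[OF lin] partial_def real_scaleR_def)
qed

section \<open>Metrics with a closed coframe are flat\<close>

lemma matrix_inv_eqI:
  fixes A B :: "real^'n^'n"
  assumes "A ** B = mat 1"
  shows "matrix_inv A = B"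
proof -
  have BA: "B ** A = mat 1" using assms matrix_left_right_inverse by blast
  have "\<exists>C. A ** C = mat 1 \<and> C ** A = mat 1" using assms BA by blast
  then have "A ** matrix_inv A = mat 1" unfolding matrix_inv_def by (rule someI2_ex) simp
  then show ?thesis using BA by (metis matrix_mul_assoc matrix_mul_lid matrix_mul_rid)
qed

lemma partial_sum_of_squares_metric:
  fixes a b :: "2 \<Rightarrow> real^2 \<Rightarrow> real"
  assumes "\<And>i. a i differentiable at q" "\<And>i. b i differentiable at q"
  shows "partial l (\<lambda>q. \<alpha> * (a i q * a j q) + \<beta> * (b i q * b j q)) q
    = \<alpha> * (a i q * partial l (a j) q + partial l (a i) q * a j q)
      + \<beta> * (b i q * partial l (b j) q + partial l (b i) q * b j q)"
  using assms by (simp add: partial_add partial_mult partial_const)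

context
  fixes g :: "2 metric" and a b :: "2 \<Rightarrow> real^2 \<Rightarrow> real" and \<alpha> \<beta> :: real and U :: "(real^2) set"
  assumes U: "open U"
    and sa: "\<And>i. smooth_on U (a i)" and sb: "\<And>i. smooth_on U (b i)"
    and ca: "\<And>q. q \<in> U \<Longrightarrow> partial 1 (a 2) q = partial 2 (a 1) q"
    and cb: "\<And>q. q \<in> U \<Longrightarrow> partial 1 (b 2) q = partial 2 (b 1) q"
    and gab: "\<And>q i j. q \<in> U \<Longrightarrow>
        metric_matrix g q $ i $ j = \<alpha> * (a i q * a j q) + \<beta> * (b i q * b j q)"
    and \<alpha>: "\<alpha> \<noteq> 0" and \<beta>: "\<beta> \<noteq> 0"
    and D: "\<And>q. q \<in> U \<Longrightarrow> a 1 q * b 2 q - a 2 q * b 1 q \<noteq> 0"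
begin

text \<open>The frame dual to the coframe \<open>(a, b)\<close>, by Cramer's rule for the \<open>2 \<times> 2\<close> matrix with rows \<open>a\<close> and
\<open>b\<close>.\<close>

definition "dual_a k q =
  (if k = (1::2) then b 2 q else - b 1 q) / (a 1 q * b 2 q - a 2 q * b 1 q)"
definition "dual_b k q =
  (if k = (1::2) then - a 2 q else a 1 q) / (a 1 q * b 2 q - a 2 q * b 1 q)"

lemma dual_pairing:
  assumes "q \<in> U"
  shows "a 1 q * dual_a 1 q + a 2 q * dual_a 2 q = 1" "b 1 q * dual_a 1 q + b 2 q * dual_a 2 q = 0"
    "a 1 q * dual_b 1 q + a 2 q * dual_b 2 q = 0" "b 1 q * dual_b 1 q + b 2 q * dual_b 2 q = 1"
proof -
  define E where "E = inverse (a 1 q * b 2 q - a 2 q * b 1 q)"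
  have "(a 1 q * b 2 q - a 2 q * b 1 q) * E = 1" using D[OF assms] by (simp add: E_def)
  then show "a 1 q * dual_a 1 q + a 2 q * dual_a 2 q = 1"
    "b 1 q * dual_a 1 q + b 2 q * dual_a 2 q = 0"
    "a 1 q * dual_b 1 q + a 2 q * dual_b 2 q = 0"
    "b 1 q * dual_b 1 q + b 2 q * dual_b 2 q = 1"
    unfolding dual_a_def dual_b_def divide_inverse E_def[symmetric]
    by (simp_all add: algebra_simps)
qed

lemma dual_completeness:
  assumes "q \<in> U"
  shows "a i q * dual_a k q + b i q * dual_b k q = (if i = k then 1 else 0)"
proof -
  define E where "E = inverse (a 1 q * b 2 q - a 2 q * b 1 q)"
  have "(a 1 q * b 2 q - a 2 q * b 1 q) * E = 1" using D[OF assms] by (simp add: E_def)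
  then show ?thesis
    unfolding dual_a_def dual_b_def divide_inverse E_def[symmetric]
    using exhaust_2[of i] exhaust_2[of k] by (auto simp: algebra_simps)
qed

lemma matrix_inv_coframe:
  assumes q: "q \<in> U"
  shows "matrix_inv (metric_matrix g q)
    = (\<chi> k l. dual_a k q * dual_a l q / \<alpha> + dual_b k q * dual_b l q / \<beta>)"
proof (rule matrix_inv_eqI)
  have "(\<alpha> * (a i q * a 1 q) + \<beta> * (b i q * b 1 q))
        * (dual_a 1 q * dual_a l q / \<alpha> + dual_b 1 q * dual_b l q / \<beta>)
      + (\<alpha> * (a i q * a 2 q) + \<beta> * (b i q * b 2 q))
        * (dual_a 2 q * dual_a l q / \<alpha> + dual_b 2 q * dual_b l q / \<beta>)
      = (a 1 q * dual_a 1 q + a 2 q * dual_a 2 q) * (a i q * dual_a l q)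
      + (b 1 q * dual_a 1 q + b 2 q * dual_a 2 q) * (\<beta> / \<alpha> * b i q * dual_a l q)
      + (a 1 q * dual_b 1 q + a 2 q * dual_b 2 q) * (\<alpha> / \<beta> * a i q * dual_b l q)
      + (b 1 q * dual_b 1 q + b 2 q * dual_b 2 q) * (b i q * dual_b l q)" for i l
    using \<alpha> \<beta> by (simp add: field_simps)
  then show "metric_matrix g q
      ** (\<chi> k l. dual_a k q * dual_a l q / \<alpha> + dual_b k q * dual_b l q / \<beta>) = mat 1"
    using dual_pairing[OF q] dual_completeness[OF q]
    by (simp add: matrix_matrix_mult_def vec_eq_iff sum_2 gab[OF q] mat_def)
qed

lemma partial_closed:
  assumes "q \<in> U"
  shows "partial i (a j) q = partial j (a i) q" "partial i (b j) q = partial j (b i) q"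
  using ca[OF assms] cb[OF assms] exhaust_2[of i] exhaust_2[of j] by auto

text \<open>Since \<open>\<partial>\<^sub>i a\<^sub>j\<close> is symmetric in \<open>i\<close> and \<open>j\<close>, the three derivatives of the metric in the Christoffel symbol
combine to \<open>2 (\<alpha> \<partial>\<^sub>i a\<^sub>j a\<^sub>l + \<beta> \<partial>\<^sub>i b\<^sub>j b\<^sub>l)\<close>, and raising the index \<open>l\<close> replaces the coframe by its dual
frame.\<close>

lemma christoffel_coframe:
  assumes q: "q \<in> U"
  shows "christoffel g q k i j
    = dual_a k q * partial i (a j) q + dual_b k q * partial i (b j) q"
proof -
  note d = smooth_on_differentiable[OF sa U q] smooth_on_differentiable[OF sb U q]
  have dg: "partial l (\<lambda>q. metric_matrix g q $ i $ j) q
    = \<alpha> * (a i q * partial l (a j) q + partial l (a i) q * a j q)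
      + \<beta> * (b i q * partial l (b j) q + partial l (b i) q * b j q)" for l i j
    using partial_cong[OF U q, of "\<lambda>q. metric_matrix g q $ i $ j"] gab
      partial_sum_of_squares_metric[OF d] by simp
  have br: "partial i (\<lambda>q. metric_matrix g q $ j $ l) q + partial j (\<lambda>q. metric_matrix g q $ i $ l) q
      - partial l (\<lambda>q. metric_matrix g q $ i $ j) q
    = (\<alpha> * partial i (a j) q * a l q + \<beta> * partial i (b j) q * b l q) * 2" for l
    unfolding dg using partial_closed[OF q, of j i] partial_closed[OF q, of l i]
      partial_closed[OF q, of l j] by (simp add: algebra_simps)
  have half: "1 / 2 * m * (x * 2) = m * x" for m x :: real by simp
  have "christoffel g q k i j =
      (dual_a k q * dual_a 1 q / \<alpha> + dual_b k q * dual_b 1 q / \<beta>)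
        * (\<alpha> * partial i (a j) q * a 1 q + \<beta> * partial i (b j) q * b 1 q)
    + (dual_a k q * dual_a 2 q / \<alpha> + dual_b k q * dual_b 2 q / \<beta>)
        * (\<alpha> * partial i (a j) q * a 2 q + \<beta> * partial i (b j) q * b 2 q)"
    by (simp only: christoffel_def br matrix_inv_coframe[OF q] sum_2 vec_lambda_beta half)
  also have "\<dots> =
      (a 1 q * dual_a 1 q + a 2 q * dual_a 2 q) * (dual_a k q * partial i (a j) q)
    + (b 1 q * dual_a 1 q + b 2 q * dual_a 2 q) * (\<beta> / \<alpha> * dual_a k q * partial i (b j) q)
    + (a 1 q * dual_b 1 q + a 2 q * dual_b 2 q) * (\<alpha> / \<beta> * dual_b k q * partial i (a j) q)
    + (b 1 q * dual_b 1 q + b 2 q * dual_b 2 q) * (dual_b k q * partial i (b j) q)"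
    using \<alpha> \<beta> by (simp add: field_simps)
  finally show ?thesis using dual_pairing[OF q] by simp
qed

lemma dual_differentiable:
  assumes q: "q \<in> U"
  shows "dual_a k differentiable at q" "dual_b k differentiable at q"
  using D[OF q] smooth_on_differentiable[OF sa U q] smooth_on_differentiable[OF sb U q]
  by (cases "k = 1"; auto simp: dual_a_def[abs_def] dual_b_def[abs_def]
      intro!: differentiable_divide differentiable_diff differentiable_mult differentiable_minus)+

text \<open>This is the derivative \<open>d(A\<^sup>-\<^sup>1) = - A\<^sup>-\<^sup>1 dA A\<^sup>-\<^sup>1\<close> of an inverse matrix: \<open>dual_a\<close> and \<open>dual_b\<close> are the columns of
the inverse of the matrix with rows \<open>a\<close> and \<open>b\<close>, and the matrix \<open>A\<^sup>-\<^sup>1 dA\<close> consists of Christoffel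
symbols.\<close>

lemma partial_dual:
  assumes q: "q \<in> U"
  shows "partial i (dual_a k) q
      = - (christoffel g q k i 1 * dual_a 1 q + christoffel g q k i 2 * dual_a 2 q)"
    and "partial i (dual_b k) q
      = - (christoffel g q k i 1 * dual_b 1 q + christoffel g q k i 2 * dual_b 2 q)"
proof -
  note d = smooth_on_differentiable[OF sa U q] smooth_on_differentiable[OF sb U q]
    dual_differentiable[OF q]
  have *: "partial i (\<lambda>q. a j q * dual_a k q + b j q * dual_b k q) q = 0" for j
    using partial_cong[OF U q, of "\<lambda>q. a j q * dual_a k q + b j q * dual_b k q"]
      dual_completeness[of _ j k] partial_const[of i "if j = k then 1 else 0"] by simp
  have s: "partial i (\<lambda>q. a j q * dual_a k q + b j q * dual_b k q) q
      = (a j q * partial i (dual_a k) q + partial i (a j) q * dual_a k q)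
      + (b j q * partial i (dual_b k) q + partial i (b j) q * dual_b k q)" for j
    using d by (simp add: partial_add partial_mult)
  have e: "a j q * partial i (dual_a k) q + b j q * partial i (dual_b k) q
      = - (partial i (a j) q * dual_a k q + partial i (b j) q * dual_b k q)" for j
    using *[of j] s[of j] by linarith
  have "partial i (dual_a k) q
      = (a 1 q * dual_a 1 q + a 2 q * dual_a 2 q) * partial i (dual_a k) q
       + (b 1 q * dual_a 1 q + b 2 q * dual_a 2 q) * partial i (dual_b k) q"
    using dual_pairing[OF q] by simp
  also have "\<dots> = dual_a 1 q * (a 1 q * partial i (dual_a k) q + b 1 q * partial i (dual_b k) q)
      + dual_a 2 q * (a 2 q * partial i (dual_a k) q + b 2 q * partial i (dual_b k) q)"
    by (simp add: algebra_simps)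
  finally show "partial i (dual_a k) q
      = - (christoffel g q k i 1 * dual_a 1 q + christoffel g q k i 2 * dual_a 2 q)"
    unfolding e christoffel_coframe[OF q] by (simp add: algebra_simps)
  have "partial i (dual_b k) q
      = (a 1 q * dual_b 1 q + a 2 q * dual_b 2 q) * partial i (dual_a k) q
       + (b 1 q * dual_b 1 q + b 2 q * dual_b 2 q) * partial i (dual_b k) q"
    using dual_pairing[OF q] by simp
  also have "\<dots> = dual_b 1 q * (a 1 q * partial i (dual_a k) q + b 1 q * partial i (dual_b k) q)
      + dual_b 2 q * (a 2 q * partial i (dual_a k) q + b 2 q * partial i (dual_b k) q)"
    by (simp add: algebra_simps)
  finally show "partial i (dual_b k) q
      = - (christoffel g q k i 1 * dual_b 1 q + christoffel g q k i 2 * dual_b 2 q)"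
    unfolding e christoffel_coframe[OF q] by (simp add: algebra_simps)
qed

text \<open>In a closed coframe the connection matrix is \<open>A\<^sup>-\<^sup>1 dA\<close>, a pure gauge, and its curvature
\<open>d\<omega> + \<omega> \<and> \<omega>\<close> vanishes identically. Locally \<open>a\<close> and \<open>b\<close> are differentials of flat coordinates, but those
coordinates are never needed.\<close>

lemma gaussian_curvature_closed_coframe:
  assumes q: "q \<in> U"
  shows "gaussian_curvature g q = 0"
proof -
  have dp: "partial i (a j) differentiable at q" "partial i (b j) differentiable at q" for i j
    by (intro smooth_on_differentiable[OF smooth_on_partial U q] sa sb)+
  have dC: "partial m (\<lambda>r. christoffel g r k i j) q
      = dual_a k q * partial m (partial i (a j)) q + partial m (dual_a k) q * partial i (a j) q
      + (dual_b k q * partial m (partial i (b j)) q + partial m (dual_b k) q * partial i (b j) q)"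
    for m k i j
    using partial_cong[OF U q, of "\<lambda>r. christoffel g r k i j"] christoffel_coframe
      dp dual_differentiable[OF q] by (simp add: partial_add partial_mult)
  have sym: "partial 2 (partial 1 (a 2)) q = partial 1 (partial 2 (a 2)) q"
    "partial 2 (partial 1 (b 2)) q = partial 1 (partial 2 (b 2)) q"
    using partial_commute[OF sa U q] partial_commute[OF sb U q] by auto
  have "riemann g q l 1 2 2 = 0" for l
    unfolding riemann_def dC sum_2 partial_dual[OF q] sym unfolding christoffel_coframe[OF q]
    by (simp add: algebra_simps)
  then show ?thesis by (simp add: gaussian_curvature_def)
qed

end

section \<open>The Levi-Civita connection of the Heisenberg group\<close>

lemma metric_matrix_heis:
  "metric_matrix (heis \<tau> \<delta>) p = vector [
     vector [1 + \<delta> * (\<tau> * p$2) * (\<tau> * p$2), - \<delta> * (\<tau> * p$2) * (\<tau> * p$1), \<delta> * (\<tau> * p$2)],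
     vector [- \<delta> * (\<tau> * p$2) * (\<tau> * p$1), - \<delta> + \<delta> * (\<tau> * p$1) * (\<tau> * p$1), - \<delta> * (\<tau> * p$1)],
     vector [\<delta> * (\<tau> * p$2), - \<delta> * (\<tau> * p$1), \<delta>]]"
  by (simp add: vec_eq_iff forall_3 metric_matrix_def heis_def heis_form_def axis_def)

lemma matrix_inv_heis:
  assumes "\<delta> * \<delta> = 1"
  shows "matrix_inv (metric_matrix (heis \<tau> \<delta>) p) = vector [
     vector [1, 0, - \<tau> * p$2],
     vector [0, - \<delta>, - \<delta> * \<tau> * p$1],
     vector [- \<tau> * p$2, - \<delta> * \<tau> * p$1, \<tau> * \<tau> * (p$2 * p$2) - \<delta> * \<tau> * \<tau> * (p$1 * p$1) + \<delta>]]"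
proof (rule matrix_inv_eqI)
  have a: "\<delta> * (\<delta> * z) = z" for z using assms by (simp add: mult.assoc[symmetric])
  show "metric_matrix (heis \<tau> \<delta>) p ** vector [
     vector [1, 0, - \<tau> * p$2],
     vector [0, - \<delta>, - \<delta> * \<tau> * p$1],
     vector [- \<tau> * p$2, - \<delta> * \<tau> * p$1, \<tau> * \<tau> * (p$2 * p$2) - \<delta> * \<tau> * \<tau> * (p$1 * p$1) + \<delta>]]
     = mat 1"
    by (simp add: vec_eq_iff forall_3 metric_matrix_heis matrix_matrix_mult_def sum_3 mat_def
        algebra_simps a assms)
qed

lemma partial_metric_matrix_heis:
  "partial l (\<lambda>q. metric_matrix (heis \<tau> \<delta>) q $ i $ j) p =
    \<delta> * (heis_form \<tau> (axis l 1) (axis i 1) - heis_form \<tau> 0 (axis i 1)) * heis_form \<tau> p (axis j 1)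
  + \<delta> * heis_form \<tau> p (axis i 1) * (heis_form \<tau> (axis l 1) (axis j 1) - heis_form \<tau> 0 (axis j 1))"
proof -
  have th: "((\<lambda>q. heis_form \<tau> q w) has_derivative (\<lambda>v. heis_form \<tau> v w - heis_form \<tau> 0 w)) (at p)" for w
    unfolding heis_form_def
    by (auto intro!: derivative_eq_intros bounded_linear_imp_has_derivative[OF bounded_linear_vec_nth]
        simp: algebra_simps)
  show ?thesis
    unfolding metric_matrix_def heis_def vec_lambda_beta
    by (subst has_derivative_partial) (auto intro!: derivative_eq_intros th simp: algebra_simps)
qed

text \<open>The last equation says that the \<open>heis_form\<close> of the Christoffel terms vanishes. Hence the vertical
component of a covariant derivative is the \<open>heis_form\<close> of the coordinatewise derivative.\<close>

lemma christoffel_heis: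
  assumes "\<delta> * \<delta> = 1"
  shows "christoffel (heis \<tau> \<delta>) p 1 i j = \<tau> * \<delta> *
      (axis i 1 $ 2 * heis_form \<tau> p (axis j 1) + heis_form \<tau> p (axis i 1) * axis j 1 $ 2)"
    and "christoffel (heis \<tau> \<delta>) p 2 i j = \<tau> *
      (axis i 1 $ 1 * heis_form \<tau> p (axis j 1) + heis_form \<tau> p (axis i 1) * axis j 1 $ 1)"
    and "christoffel (heis \<tau> \<delta>) p 3 i j
      = \<tau> * (p $ 1 * christoffel (heis \<tau> \<delta>) p 2 i j - p $ 2 * christoffel (heis \<tau> \<delta>) p 1 i j)"
proof -
  have a: "\<delta> * (\<delta> * z) = z" for z using assms by (simp add: mult.assoc[symmetric])
  show 1: "christoffel (heis \<tau> \<delta>) p 1 i j = \<tau> * \<delta> *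
      (axis i 1 $ 2 * heis_form \<tau> p (axis j 1) + heis_form \<tau> p (axis i 1) * axis j 1 $ 2)"
    using exhaust_3[of i] exhaust_3[of j]
    by (elim disjE; simp add: christoffel_def sum_3 matrix_inv_heis[OF assms]
        partial_metric_matrix_heis heis_form_def axis_def algebra_simps a assms)
  show 2: "christoffel (heis \<tau> \<delta>) p 2 i j = \<tau> *
      (axis i 1 $ 1 * heis_form \<tau> p (axis j 1) + heis_form \<tau> p (axis i 1) * axis j 1 $ 1)"
    using exhaust_3[of i] exhaust_3[of j]
    by (elim disjE; simp add: christoffel_def sum_3 matrix_inv_heis[OF assms]
        partial_metric_matrix_heis heis_form_def axis_def algebra_simps a assms)
  show "christoffel (heis \<tau> \<delta>) p 3 i j
      = \<tau> * (p $ 1 * christoffel (heis \<tau> \<delta>) p 2 i j - p $ 2 * christoffel (heis \<tau> \<delta>) p 1 i j)"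
    unfolding 1 2 using exhaust_3[of i] exhaust_3[of j]
    by (elim disjE; simp add: christoffel_def sum_3 matrix_inv_heis[OF assms]
        partial_metric_matrix_heis heis_form_def axis_def algebra_simps a assms)
qed

text \<open>The components with respect to the left-invariant frame \<open>E\<^sub>1 = \<partial>\<^sub>x - \<tau> y \<partial>\<^sub>z\<close>, \<open>E\<^sub>2 = \<partial>\<^sub>y + \<tau> x \<partial>\<^sub>z\<close>,
\<open>E\<^sub>3 = \<partial>\<^sub>z\<close>: the first two coincide with standard coordinates, the third one is \<open>heis_form\<close>.\<close>

lemma covariant_derivative_heis:
  fixes F N :: "real^2 \<Rightarrow> real^3"
  assumes "\<delta> * \<delta> = 1"
  defines "X \<equiv> \<lambda>p v. frechet_derivative F (at p) v"
  shows "covariant_derivative (heis \<tau> \<delta>) F N p v $ 1 = frechet_derivative N (at p) v $ 1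
      + \<tau> * \<delta> * (X p v $ 2 * heis_form \<tau> (F p) (N p) + heis_form \<tau> (F p) (X p v) * N p $ 2)"
    and "covariant_derivative (heis \<tau> \<delta>) F N p v $ 2 = frechet_derivative N (at p) v $ 2
      + \<tau> * (X p v $ 1 * heis_form \<tau> (F p) (N p) + heis_form \<tau> (F p) (X p v) * N p $ 1)"
    and "heis_form \<tau> (F p) (covariant_derivative (heis \<tau> \<delta>) F N p v)
      = heis_form \<tau> (F p) (frechet_derivative N (at p) v)"
  unfolding covariant_derivative_def X_def
  by (simp_all add: sum_3 christoffel_heis[OF assms(1)] heis_form_def axis_def algebra_simps)

text \<open>For an endomorphism \<open>S\<close> of a plane and two linear forms,
\<open>(\<alpha> \<circ> S) \<and> \<beta> + \<alpha> \<and> (\<beta> \<circ> S) = tr S \<cdot> \<alpha> \<and> \<beta>\<close>. Applied to \<open>\<alpha> \<circ> dF\<close> and \<open>\<beta> \<circ> dF\<close> this gives the mean curvature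
directly from the covariant derivative of the normal, and neither the shape operator nor an
orthonormal basis has to be computed. The wedge products are evaluated on the coordinate basis.\<close>

lemma trace_shape_operator:
  fixes F N :: "real^2 \<Rightarrow> real^3" and \<alpha> \<beta> :: "real^3 \<Rightarrow> real"
  assumes lin: "linear (frechet_derivative F (at p))" and inj: "inj (frechet_derivative F (at p))"
    and tangent: "\<And>i. covariant_derivative g F N p (axis i 1) \<in> range (frechet_derivative F (at p))"
    and \<alpha>: "linear \<alpha>" and \<beta>: "linear \<beta>"
  defines "D \<equiv> \<lambda>i. covariant_derivative g F N p (axis i 1)"
    and "X \<equiv> \<lambda>i. frechet_derivative F (at p) (axis i 1)"
  shows "(\<alpha> (D 1) * \<beta> (X 2) - \<alpha> (D 2) * \<beta> (X 1)) + (\<alpha> (X 1) * \<beta> (D 2) - \<alpha> (X 2) * \<beta> (D 1))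
    = - 2 * mean_curvature g F N p * (\<alpha> (X 1) * \<beta> (X 2) - \<alpha> (X 2) * \<beta> (X 1))"
proof -
  define S where "S i = shape_operator g F N p (axis i 1)" for i
  have S: "frechet_derivative F (at p) (S i) = - D i" for i
  proof -
    obtain w where w: "frechet_derivative F (at p) w = D i" using tangent[of i] by (auto simp: D_def)
    then have w': "frechet_derivative F (at p) (- w) = - D i" using linear_neg[OF lin] by metis
    then have "w' = - w" if "frechet_derivative F (at p) w' = - D i" for w'
      using injD[OF inj] that by metis
    then have "(THE w'. frechet_derivative F (at p) w' = - D i) = - w"
      using w' by (intro the_equality)
    then show ?thesis using w' by (simp add: S_def shape_operator_def D_def)
  qed
  have "S i = S i $ 1 *\<^sub>R axis 1 1 + S i $ 2 *\<^sub>R axis 2 1" for i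
    by (simp add: vec_eq_iff forall_2 axis_def)
  then have "frechet_derivative F (at p) (S i) = S i $ 1 *\<^sub>R X 1 + S i $ 2 *\<^sub>R X 2" for i
    unfolding X_def by (metis linear_add[OF lin] linear_scale[OF lin])
  then have D: "D i = - (S i $ 1 *\<^sub>R X 1 + S i $ 2 *\<^sub>R X 2)" for i
    using S by (metis minus_minus)
  have a: "\<phi> (D i) = - (S i $ 1 * \<phi> (X 1) + S i $ 2 * \<phi> (X 2))"
    if "linear \<phi>" for \<phi> :: "real^3 \<Rightarrow> real" and i
    unfolding D by (simp add: linear_neg[OF that] linear_add[OF that] linear_scale[OF that] linear_diff[OF that])
  have "mean_curvature g F N p = 1/2 * (S 1 $ 1 + S 2 $ 2)"
    by (simp add: mean_curvature_def trace_def matrix_def sum_2 S_def)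
  then show ?thesis unfolding a[OF \<alpha>] a[OF \<beta>] by (simp add: algebra_simps)
qed

section \<open>Structure equations of constant angle surfaces\<close>

lemma frechet_derivative_component:
  fixes f :: "'a::euclidean_space \<Rightarrow> real^'n"
  assumes "f differentiable at p"
  shows "frechet_derivative f (at p) v $ k = frechet_derivative (\<lambda>q. f q $ k) (at p) v"
proof -
  have "((\<lambda>q. f q $ k) has_derivative (\<lambda>v. frechet_derivative f (at p) v $ k)) (at p)"
    using assms unfolding frechet_derivative_works
    by (rule bounded_linear.has_derivative[OF bounded_linear_vec_nth])
  from frechet_derivative_at[OF this] show ?thesis by metis
qed

text \<open>If all \<open>2 \<times> 2\<close> minors vanish, the rank is at most one and the kernel is not trivial.\<close>

lemma inj_linear_3_2_minor:
  fixes L :: "real^2 \<Rightarrow> real^3"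
  assumes "linear L" "inj L"
    and "\<And>k l. L (axis 1 1) $ k * L (axis 2 1) $ l = L (axis 2 1) $ k * L (axis 1 1) $ l"
  shows False
proof -
  have zero: "v = 0" if "L v = 0" for v
    using assms(1,2) that linear_injective_0 by blast
  have comb: "L (a *\<^sub>R axis 1 1 + b *\<^sub>R axis 2 1) $ k = a * L (axis 1 1) $ k + b * L (axis 2 1) $ k" for a b k
    using assms(1) by (simp add: linear_add linear_scale)
  have "L (axis 2 1) $ l = 0" for l
  proof -
    have "L (L (axis 2 1) $ l *\<^sub>R axis 1 1 + (- L (axis 1 1) $ l) *\<^sub>R axis 2 1) = 0"
      unfolding vec_eq_iff comb using assms(3)[of _ l] by (auto simp: algebra_simps)
    from arg_cong[OF zero[OF this], of "\<lambda>v. v $ 1"] show ?thesis by (simp add: axis_def)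
  qed
  then have "L (axis 2 1) = 0" by (simp add: vec_eq_iff)
  from arg_cong[OF zero[OF this], of "\<lambda>v. v $ 2"] show False by (simp add: axis_def)
qed

text \<open>If \<open>(a, b)\<close> is orthogonal to \<open>(n1, n2)\<close> for the form \<open>dx\<^sup>2 - \<delta> dy\<^sup>2\<close>, it is a multiple of \<open>(\<delta> n2, n1)\<close>.
This is used for the tangent direction of the base curve of a vertical surface as well as for the
differential of the normal.\<close>

lemma proportional_of_cross_eq_0:
  fixes a b :: real
  assumes "n1 * a = \<delta> * (n2 * b)" and "n1 * n1 - \<delta> * (n2 * n2) = r"
  shows "r * a = \<delta> * n2 * (n1 * b - n2 * a)" "r * b = n1 * (n1 * b - n2 * a)"
proof -
  have "n1 * (n1 * a) = n1 * (\<delta> * (n2 * b))" using assms(1) by simp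
  then show "r * a = \<delta> * n2 * (n1 * b - n2 * a)"
    unfolding assms(2)[symmetric] by (simp add: algebra_simps)
  have "n2 * (n1 * a) = n2 * (\<delta> * (n2 * b))" using assms(1) by simp
  then show "r * b = n1 * (n1 * b - n2 * a)"
    unfolding assms(2)[symmetric] by (simp add: algebra_simps)
qed

lemma linear_heis_form: "linear (heis_form \<tau> q)"
  by (rule linearI) (simp_all add: heis_form_def algebra_simps)

lemma linear_component: "linear (\<lambda>v::real^3. v $ k)"
  by (rule linearI) simp_all

text \<open>A chart of a constant angle surface. The number \<open>c\<close> is the \<open>E\<^sub>3\<close>-component of the normal, so that the
angle function is \<open>\<epsilon> \<delta> c\<close>.

In what follows a 1-form on the parameter domain is a function \<open>\<alpha>\<close> of an index \<open>i\<close> and a point: its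
components are \<open>\<alpha> 1\<close> and \<open>\<alpha> 2\<close>. Accordingly \<open>\<alpha> 1 * \<beta> 2 - \<alpha> 2 * \<beta> 1\<close> is the wedge product and
\<open>partial 1 (\<alpha> 2) - partial 2 (\<alpha> 1)\<close> the exterior derivative.\<close>

locale helix_chart =
  fixes \<tau> \<delta> \<epsilon> c :: real and U :: "(real^2) set" and F N :: "real^2 \<Rightarrow> real^3"
  assumes \<delta>: "\<delta> \<in> {1, -1}" and \<epsilon>: "\<epsilon> \<in> {1, -1}" and U: "open U"
    and smooth_F: "smooth_on U F" and smooth_N: "smooth_on U N"
    and inj: "\<And>p. p \<in> U \<Longrightarrow> inj (frechet_derivative F (at p))"
    and orth: "\<And>p v. p \<in> U \<Longrightarrow> heis \<tau> \<delta> (F p) (N p) (frechet_derivative F (at p) v) = 0"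
    and unit_normal: "\<And>p. p \<in> U \<Longrightarrow> heis \<tau> \<delta> (F p) (N p) (N p) = \<epsilon>"
    and angle: "\<And>p. p \<in> U \<Longrightarrow> heis_form \<tau> (F p) (N p) = c"
begin

abbreviation "x q \<equiv> F q $ 1"
abbreviation "y q \<equiv> F q $ 2"
abbreviation "n1 q \<equiv> N q $ 1"
abbreviation "n2 q \<equiv> N q $ 2"
abbreviation "dx i \<equiv> partial i (\<lambda>q. F q $ 1)"
abbreviation "dy i \<equiv> partial i (\<lambda>q. F q $ 2)"
abbreviation "dz i \<equiv> partial i (\<lambda>q. F q $ 3)"
abbreviation "dn1 i \<equiv> partial i (\<lambda>q. N q $ 1)"
abbreviation "dn2 i \<equiv> partial i (\<lambda>q. N q $ 2)"

text \<open>The pullback of the contact form \<open>heis_form\<close> under \<open>F\<close>.\<close>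

definition zeta :: "2 \<Rightarrow> real^2 \<Rightarrow> real" where
  "zeta i q = dz i q + \<tau> * (y q * dx i q - x q * dy i q)"

lemma \<delta>\<delta>: "\<delta> * \<delta> = 1" and \<epsilon>\<epsilon>: "\<epsilon> * \<epsilon> = 1"
  using \<delta> \<epsilon> by auto

lemma smooth_components: "smooth_on U (\<lambda>q. F q $ k)" "smooth_on U (\<lambda>q. N q $ k)"
  using smooth_F smooth_N U by (simp_all add: smooth_on_component)

lemma smooth_zeta: "smooth_on U (zeta i)"
  unfolding zeta_def[abs_def]
  by (intro smooth_on_add smooth_on_mult smooth_on_diff smooth_on_const smooth_on_partial
      smooth_components U)

lemma dF_component:
  "p \<in> U \<Longrightarrow> frechet_derivative F (at p) (axis i 1) $ k = partial i (\<lambda>q. F q $ k) p"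
  "p \<in> U \<Longrightarrow> frechet_derivative N (at p) (axis i 1) $ k = partial i (\<lambda>q. N q $ k) p"
  using frechet_derivative_component[OF smooth_on_differentiable[OF smooth_F U]]
    frechet_derivative_component[OF smooth_on_differentiable[OF smooth_N U]]
  by (simp_all add: partial_def)

lemma heis_form_dF: "p \<in> U \<Longrightarrow> heis_form \<tau> (F p) (frechet_derivative F (at p) (axis i 1)) = zeta i p"
  by (simp add: heis_form_def dF_component zeta_def)

lemma differentiable:
  assumes "p \<in> U"
  shows "(\<lambda>q. F q $ k) differentiable at p" "(\<lambda>q. N q $ k) differentiable at p"
    "partial i (\<lambda>q. F q $ k) differentiable at p" "partial i (\<lambda>q. N q $ k) differentiable at p"
    "zeta i differentiable at p"
  using assms
  by (auto intro!: smooth_on_differentiable[OF _ U] smooth_on_partial smooth_components smooth_zeta)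

lemma normal:
  assumes "p \<in> U"
  shows "n1 p * dx i p - \<delta> * (n2 p * dy i p) + \<delta> * (c * zeta i p) = 0"
  using orth[OF assms, of "axis i 1"]
  by (simp add: heis_def heis_form_dF angle dF_component assms)

lemma unit:
  assumes "p \<in> U"
  shows "n1 p * n1 p - \<delta> * (n2 p * n2 p) + \<delta> * (c * c) = \<epsilon>"
  using unit_normal[OF assms] by (simp add: heis_def angle assms)

lemma d_unit:
  assumes p: "p \<in> U"
  shows "n1 p * dn1 i p = \<delta> * (n2 p * dn2 i p)"
proof -
  have "partial i (\<lambda>q. n1 q * n1 q - \<delta> * (n2 q * n2 q) + \<delta> * (c * c)) p = partial i (\<lambda>q. \<epsilon>) p"
    by (rule partial_cong[OF U p]) (rule unit)
  then show ?thesis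
    using differentiable[OF p] by (simp add: partial_add partial_diff partial_mult partial_const)
qed

lemma d_zeta:
  assumes p: "p \<in> U"
  shows "partial 1 (zeta 2) p - partial 2 (zeta 1) p = - 2 * \<tau> * (dx 1 p * dy 2 p - dx 2 p * dy 1 p)"
proof -
  have c: "partial 2 (dx 1) p = partial 1 (dx 2) p" "partial 2 (dy 1) p = partial 1 (dy 2) p"
    "partial 2 (dz 1) p = partial 1 (dz 2) p"
    using partial_commute[OF smooth_components(1) U p] by auto
  have z: "partial j (zeta i) p = partial j (dz i) p
      + \<tau> * ((y p * partial j (dx i) p + dy j p * dx i p) - (x p * partial j (dy i) p + dx j p * dy i p))"
    for i j
    unfolding zeta_def[abs_def] using differentiable(1,3)[OF p]
    by (simp add: partial_add partial_diff partial_mult partial_const)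
  show ?thesis unfolding z c by (simp add: algebra_simps)
qed

text \<open>The exterior derivative of the relation \<open>normal\<close>. It expresses that the tangent planes are
integrable, or equivalently that the shape operator is symmetric; the right-hand side comes from
\<open>d_zeta\<close>.\<close>

lemma symmetric_shape:
  assumes p: "p \<in> U"
  shows "(dn1 1 p * dx 2 p - dn1 2 p * dx 1 p) - \<delta> * (dn2 1 p * dy 2 p - dn2 2 p * dy 1 p)
    = 2 * \<tau> * \<delta> * c * (dx 1 p * dy 2 p - dx 2 p * dy 1 p)"
proof -
  have e: "n1 p * partial j (dx i) p + dn1 j p * dx i p
      - \<delta> * (n2 p * partial j (dy i) p + dn2 j p * dy i p) + \<delta> * (c * partial j (zeta i) p) = 0" for i j
  proof -
    have "partial j (\<lambda>q. n1 q * dx i q - \<delta> * (n2 q * dy i q) + \<delta> * (c * zeta i q)) p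
        = partial j (\<lambda>q. 0) p"
      by (rule partial_cong[OF U p]) (rule normal)
    then show ?thesis
      using differentiable[OF p] by (simp add: partial_add partial_diff partial_mult partial_const)
  qed
  have c: "partial 2 (dx 1) p = partial 1 (dx 2) p" "partial 2 (dy 1) p = partial 1 (dy 2) p"
    using partial_commute[OF smooth_components(1) U p] by auto
  have dz: "partial 2 (zeta 1) p
      = partial 1 (zeta 2) p + 2 * \<tau> * (dx 1 p * dy 2 p - dx 2 p * dy 1 p)"
    using d_zeta[OF p] by simp
  show ?thesis using e[of 1 2] e[of 2 1] unfolding c dz by (simp add: algebra_simps)
qed

text \<open>Passing from \<open>dz\<close> to \<open>\<zeta>\<close> adds combinations of the first two rows to the third row of the matrix of \<open>dF\<close>,
so the minors in the frame vanish together only if those in standard coordinates do.\<close>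

lemma immersion:
  assumes p: "p \<in> U"
  shows "\<not> (dx 1 p * dy 2 p = dx 2 p * dy 1 p \<and> dx 1 p * zeta 2 p = dx 2 p * zeta 1 p
    \<and> dy 1 p * zeta 2 p = dy 2 p * zeta 1 p)"
proof
  assume a: "dx 1 p * dy 2 p = dx 2 p * dy 1 p \<and> dx 1 p * zeta 2 p = dx 2 p * zeta 1 p
    \<and> dy 1 p * zeta 2 p = dy 2 p * zeta 1 p"
  have "dx 1 p * dz 2 p - dx 2 p * dz 1 p = (dx 1 p * zeta 2 p - dx 2 p * zeta 1 p)
      + \<tau> * x p * (dx 1 p * dy 2 p - dx 2 p * dy 1 p)"
    and "dy 1 p * dz 2 p - dy 2 p * dz 1 p = (dy 1 p * zeta 2 p - dy 2 p * zeta 1 p)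
      + \<tau> * y p * (dx 1 p * dy 2 p - dx 2 p * dy 1 p)"
    unfolding zeta_def by (simp_all add: algebra_simps)
  then have "dx 1 p * dz 2 p = dx 2 p * dz 1 p" "dy 1 p * dz 2 p = dy 2 p * dz 1 p"
    using a by simp_all
  then have "partial 1 (\<lambda>q. F q $ k) p * partial 2 (\<lambda>q. F q $ l) p
      = partial 2 (\<lambda>q. F q $ k) p * partial 1 (\<lambda>q. F q $ l) p" for k l
    using a exhaust_3[of k] exhaust_3[of l] by (elim disjE) (simp_all add: mult.commute)
  then show False
    using inj_linear_3_2_minor[OF linear_frechet_derivative inj[OF p]]
      smooth_on_differentiable[OF smooth_F U p] by (simp add: dF_component p)
qed

text \<open>Equality of dimensions makes the tangent plane all of the orthogonal complement of the normal. It is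
what gives the covariant derivative of the normal a preimage under \<open>dF\<close>, so that the definite
description in the shape operator denotes.\<close>

lemma range_dF:
  assumes p: "p \<in> U"
  shows "range (frechet_derivative F (at p)) = {D. heis \<tau> \<delta> (F p) (N p) D = 0}"
proof (rule subspace_dim_equal)
  have lin: "linear (frechet_derivative F (at p))"
    using smooth_on_differentiable[OF smooth_F U p] by (rule linear_frechet_derivative)
  show "subspace (range (frechet_derivative F (at p)))"
    using lin by (simp add: linear_subspace_image)
  show sub: "subspace {D. heis \<tau> \<delta> (F p) (N p) D = 0}"
    by (intro linear_subspace_kernel linearI) (simp_all add: heis_def heis_form_def algebra_simps)
  show "range (frechet_derivative F (at p)) \<subseteq> {D. heis \<tau> \<delta> (F p) (N p) D = 0}"
    using orth[OF p] by auto
  have "N p \<notin> {D. heis \<tau> \<delta> (F p) (N p) D = 0}" using unit_normal[OF p] \<epsilon> by auto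
  then have "span {D. heis \<tau> \<delta> (F p) (N p) D = 0} \<noteq> UNIV" using sub by (metis span_eq_iff UNIV_I)
  then have "dim {D. heis \<tau> \<delta> (F p) (N p) D = 0} < 3"
    using dim_eq_full[of "{D. heis \<tau> \<delta> (F p) (N p) D = 0}"]
      dim_subset_UNIV[of "{D. heis \<tau> \<delta> (F p) (N p) D = 0}"] by simp
  moreover have "dim (range (frechet_derivative F (at p))) = 2"
    using dim_image_eq[OF lin, of UNIV] inj[OF p] by simp
  ultimately show "dim {D. heis \<tau> \<delta> (F p) (N p) D = 0} \<le> dim (range (frechet_derivative F (at p)))"
    by simp
qed

lemma d_angle:
  assumes p: "p \<in> U"
  shows "heis_form \<tau> (F p) (frechet_derivative N (at p) (axis i 1)) = \<tau> * (n2 p * dx i p - n1 p * dy i p)"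
proof -
  have "partial i (\<lambda>q. N q $ 3 + \<tau> * (F q $ 2 * N q $ 1 - F q $ 1 * N q $ 2)) p = partial i (\<lambda>q. c) p"
    by (rule partial_cong[OF U p]) (use angle in \<open>simp add: heis_form_def\<close>)
  then have "partial i (\<lambda>q. N q $ 3) p
      + \<tau> * ((y p * dn1 i p + dy i p * n1 p) - (x p * dn2 i p + dx i p * n2 p)) = 0"
    using differentiable(1,2)[OF p] by (simp add: partial_add partial_diff partial_mult partial_const)
  then have "partial i (\<lambda>q. N q $ 3) p
      = - (\<tau> * ((y p * dn1 i p + dy i p * n1 p) - (x p * dn2 i p + dx i p * n2 p)))" by linarith
  then show ?thesis unfolding heis_form_def dF_component[OF p] by (simp only: algebra_simps)
qed

lemma weingarten:
  assumes p: "p \<in> U"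
  defines "D \<equiv> \<lambda>i. covariant_derivative (heis \<tau> \<delta>) F N p (axis i 1)"
  shows "D i $ 1 = dn1 i p + \<tau> * \<delta> * (dy i p * c + zeta i p * n2 p)"
    and "D i $ 2 = dn2 i p + \<tau> * (dx i p * c + zeta i p * n1 p)"
    and "heis_form \<tau> (F p) (D i) = \<tau> * (n2 p * dx i p - n1 p * dy i p)"
  unfolding D_def covariant_derivative_heis[OF \<delta>\<delta>]
  unfolding dF_component[OF p] heis_form_dF[OF p] angle[OF p] d_angle[OF p] by simp_all

lemma trace:
  assumes p: "p \<in> U" and "linear \<alpha>" "linear \<beta>"
  defines "D \<equiv> \<lambda>i. covariant_derivative (heis \<tau> \<delta>) F N p (axis i 1)"
    and "X \<equiv> \<lambda>i. frechet_derivative F (at p) (axis i 1)"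
  shows "(\<alpha> (D 1) * \<beta> (X 2) - \<alpha> (D 2) * \<beta> (X 1)) + (\<alpha> (X 1) * \<beta> (D 2) - \<alpha> (X 2) * \<beta> (D 1))
    = - 2 * mean_curvature (heis \<tau> \<delta>) F N p * (\<alpha> (X 1) * \<beta> (X 2) - \<alpha> (X 2) * \<beta> (X 1))"
proof -
  have "heis \<tau> \<delta> (F p) (N p) (D i) = n1 p * dn1 i p - \<delta> * (n2 p * dn2 i p)" for i
    unfolding heis_def D_def weingarten[OF p] angle[OF p] by (simp add: algebra_simps)
  then have "D i \<in> range (frechet_derivative F (at p))" for i
    unfolding range_dF[OF p] using d_unit[OF p] by simp
  then have t: "covariant_derivative (heis \<tau> \<delta>) F N p (axis i 1)
      \<in> range (frechet_derivative F (at p))" for i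
    by (simp add: D_def)
  have "linear (frechet_derivative F (at p))"
    using smooth_on_differentiable[OF smooth_F U p] by (rule linear_frechet_derivative)
  then show ?thesis
    unfolding D_def X_def
    by (rule trace_shape_operator[where \<alpha> = \<alpha> and \<beta> = \<beta> and F = F and N = N and p = p
          and g = "heis \<tau> \<delta>", OF _ inj[OF p] t \<open>linear \<alpha>\<close> \<open>linear \<beta>\<close>])
qed

end

section \<open>Vertical and transversal constant angle surfaces\<close>

context helix_chart begin

lemma vertical_forms:
  assumes c: "c = 0" and p: "p \<in> U"
  shows "\<epsilon> * dx i p = \<delta> * n2 p * (n1 p * dy i p - n2 p * dx i p)"
    and "\<epsilon> * dy i p = n1 p * (n1 p * dy i p - n2 p * dx i p)"
    and "\<epsilon> * dn1 i p = \<delta> * n2 p * (n1 p * dn2 i p - n2 p * dn1 i p)"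
    and "\<epsilon> * dn2 i p = n1 p * (n1 p * dn2 i p - n2 p * dn1 i p)"
  using proportional_of_cross_eq_0[of "n1 p" "dx i p" \<delta> "n2 p" "dy i p" \<epsilon>]
    proportional_of_cross_eq_0[of "n1 p" "dn1 i p" \<delta> "n2 p" "dn2 i p" \<epsilon>]
    normal[OF p, of i] unit[OF p] d_unit[OF p, of i] c by simp_all

text \<open>For \<open>c = 0\<close> the vertical field \<open>E\<^sub>3\<close> is tangent to the surface, which therefore projects to a curve in
the \<open>xy\<close>-plane.\<close>

lemma vertical_dx_dy:
  assumes c: "c = 0" and p: "p \<in> U"
  shows "dx 1 p * dy 2 p = dx 2 p * dy 1 p"
proof -
  have "(\<epsilon> * dx 1 p) * (\<epsilon> * dy 2 p) = (\<epsilon> * dx 2 p) * (\<epsilon> * dy 1 p)"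
    unfolding vertical_forms(1,2)[OF assms] by (simp add: mult_ac)
  then show ?thesis using \<epsilon> by auto
qed

text \<open>The normal turns only along the base curve, and the mean curvature is, up to sign, half the curvature of
that curve: the two equations are \<open>dn1 \<and> \<zeta> = - 2 H dx \<and> \<zeta>\<close> and \<open>dn2 \<and> \<zeta> = - 2 H dy \<and> \<zeta>\<close>.\<close>

lemma vertical_mean_curvature:
  assumes c: "c = 0" and p: "p \<in> U"
  defines "H \<equiv> mean_curvature (heis \<tau> \<delta>) F N p"
  shows "dn1 1 p * zeta 2 p - dn1 2 p * zeta 1 p = - 2 * H * (dx 1 p * zeta 2 p - dx 2 p * zeta 1 p)"
    and "dn2 1 p * zeta 2 p - dn2 2 p * zeta 1 p = - 2 * H * (dy 1 p * zeta 2 p - dy 2 p * zeta 1 p)"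
proof -
  have "dn1 1 p * zeta 2 p - dn1 2 p * zeta 1 p - \<tau> * n1 p * (dx 1 p * dy 2 p - dx 2 p * dy 1 p)
      = - 2 * H * (dx 1 p * zeta 2 p - dx 2 p * zeta 1 p)"
    using trace[OF p linear_component[of 1] linear_heis_form[of \<tau> "F p"]]
    unfolding weingarten[OF p] heis_form_dF[OF p] dF_component[OF p] c H_def
    by (simp add: algebra_simps)
  then show "dn1 1 p * zeta 2 p - dn1 2 p * zeta 1 p
      = - 2 * H * (dx 1 p * zeta 2 p - dx 2 p * zeta 1 p)"
    using vertical_dx_dy[OF c p] by simp
  have "dn2 1 p * zeta 2 p - dn2 2 p * zeta 1 p - \<tau> * n2 p * (dx 1 p * dy 2 p - dx 2 p * dy 1 p)
      = - 2 * H * (dy 1 p * zeta 2 p - dy 2 p * zeta 1 p)"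
    using trace[OF p linear_component[of 2] linear_heis_form[of \<tau> "F p"]]
    unfolding weingarten[OF p] heis_form_dF[OF p] dF_component[OF p] c H_def
    by (simp add: algebra_simps)
  then show "dn2 1 p * zeta 2 p - dn2 2 p * zeta 1 p
      = - 2 * H * (dy 1 p * zeta 2 p - dy 2 p * zeta 1 p)"
    using vertical_dx_dy[OF c p] by simp
qed

text \<open>Up to the sign \<open>\<epsilon>\<close> this is the arc length form of the base curve: \<open>dx\<close> and \<open>dy\<close> are \<open>\<epsilon> \<delta> n2\<close> and
\<open>\<epsilon> n1\<close> times it.\<close>

definition arc :: "2 \<Rightarrow> real^2 \<Rightarrow> real" where
  "arc i q = n1 q * dy i q - n2 q * dx i q"

lemma arc_zeta_independent:
  assumes c: "c = 0" and p: "p \<in> U"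
  shows "arc 1 p * zeta 2 p - arc 2 p * zeta 1 p \<noteq> 0"
proof
  assume a: "arc 1 p * zeta 2 p - arc 2 p * zeta 1 p = 0"
  have "\<epsilon> * (dx 1 p * zeta 2 p - dx 2 p * zeta 1 p) = (\<epsilon> * dx 1 p) * zeta 2 p - (\<epsilon> * dx 2 p) * zeta 1 p"
    by (simp add: algebra_simps)
  also have "\<dots> = \<delta> * n2 p * (arc 1 p * zeta 2 p - arc 2 p * zeta 1 p)"
    unfolding vertical_forms(1)[OF assms] arc_def by (simp add: algebra_simps)
  finally have 1: "dx 1 p * zeta 2 p = dx 2 p * zeta 1 p" using a \<epsilon> by auto
  have "\<epsilon> * (dy 1 p * zeta 2 p - dy 2 p * zeta 1 p) = (\<epsilon> * dy 1 p) * zeta 2 p - (\<epsilon> * dy 2 p) * zeta 1 p"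
    by (simp add: algebra_simps)
  also have "\<dots> = n1 p * (arc 1 p * zeta 2 p - arc 2 p * zeta 1 p)"
    unfolding vertical_forms(2)[OF assms] arc_def by (simp add: algebra_simps)
  finally have 2: "dy 1 p * zeta 2 p = dy 2 p * zeta 1 p" using a \<epsilon> by auto
  show False using immersion[OF p] 1 2 vertical_dx_dy[OF c p] by blast
qed

text \<open>Both forms \<open>arc\<close> and \<open>zeta\<close> are closed: the first because \<open>dn1\<close>, \<open>dn2\<close> are proportional to \<open>dx\<close>, \<open>dy\<close>
in the way that makes the wedge products cancel, the second because \<open>dx \<and> dy = 0\<close>. The induced metric is
\<open>- \<delta> \<epsilon> arc\<^sup>2 + \<delta> zeta\<^sup>2\<close>.\<close>

lemma vertical_flat:
  assumes c: "c = 0" and p: "p \<in> U"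
  shows "gaussian_curvature (induced_metric (heis \<tau> \<delta>) F) p = 0"
proof (rule gaussian_curvature_closed_coframe[where a = arc and b = zeta and \<alpha> = "- \<delta> * \<epsilon>" and \<beta> = \<delta>
        and U = U])
  show "smooth_on U (arc i)" for i
    unfolding arc_def[abs_def]
    by (intro smooth_on_mult smooth_on_diff smooth_on_partial smooth_components U)
  fix q assume q: "q \<in> U"
  have "partial 2 (dx 1) q = partial 1 (dx 2) q" "partial 2 (dy 1) q = partial 1 (dy 2) q"
    using partial_commute[OF smooth_components(1) U q] by auto
  moreover have "partial j (arc i) q = n1 q * partial j (dy i) q + dn1 j q * dy i q
      - (n2 q * partial j (dx i) q + dn2 j q * dx i q)" for i j
    unfolding arc_def[abs_def] using differentiable[OF q] by (simp add: partial_diff partial_mult)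
  moreover have "dn1 1 q * dy 2 q - dn1 2 q * dy 1 q - (dn2 1 q * dx 2 q - dn2 2 q * dx 1 q) = 0"
  proof -
    have "\<epsilon> * \<epsilon> * (dn1 1 q * dy 2 q - dn1 2 q * dy 1 q - (dn2 1 q * dx 2 q - dn2 2 q * dx 1 q))
      = (\<epsilon> * dn1 1 q) * (\<epsilon> * dy 2 q) - (\<epsilon> * dn1 2 q) * (\<epsilon> * dy 1 q)
        - ((\<epsilon> * dn2 1 q) * (\<epsilon> * dx 2 q) - (\<epsilon> * dn2 2 q) * (\<epsilon> * dx 1 q))"
      by (simp add: algebra_simps)
    also have "\<dots> = 0"
      unfolding vertical_forms[OF c q] by (simp add: mult_ac)
    finally show ?thesis by (simp add: \<epsilon>\<epsilon>)
  qed
  ultimately show "partial 1 (arc 2) q = partial 2 (arc 1) q" by simp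
  show "partial 1 (zeta 2) q = partial 2 (zeta 1) q"
    using d_zeta[OF q] vertical_dx_dy[OF c q] by simp
  show "arc 1 q * zeta 2 q - arc 2 q * zeta 1 q \<noteq> 0"
    by (rule arc_zeta_independent[OF c q])
  fix i j
  have "dx i q * dx j q - \<delta> * (dy i q * dy j q)
      = (\<epsilon> * dx i q) * (\<epsilon> * dx j q) - \<delta> * ((\<epsilon> * dy i q) * (\<epsilon> * dy j q))"
    using \<epsilon> by auto
  also have "\<dots> = (\<delta> * n2 q * arc i q) * (\<delta> * n2 q * arc j q) - \<delta> * ((n1 q * arc i q) * (n1 q * arc j q))"
    unfolding vertical_forms(1,2)[OF c q] arc_def by simp
  also have "\<dots> = - \<delta> * (n1 q * n1 q - \<delta> * (n2 q * n2 q)) * (arc i q * arc j q)"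
    by (simp add: algebra_simps)
  also have "\<dots> = - \<delta> * \<epsilon> * (arc i q * arc j q)" using unit[OF q] c by simp
  finally show "metric_matrix (induced_metric (heis \<tau> \<delta>) F) q $ i $ j
      = - \<delta> * \<epsilon> * (arc i q * arc j q) + \<delta> * (zeta i q * zeta j q)"
    by (simp add: metric_matrix_def induced_metric_def heis_def heis_form_dF[OF q] dF_component[OF q])
qed (use U p smooth_zeta \<delta> \<epsilon> in auto)

text \<open>The rotation form \<open>w\<close> of the normal is annihilated by the wedge product with \<open>zeta\<close> (minimality) and
with \<open>arc\<close> (symmetry of the shape operator). As these two forms are independent, \<open>w = 0\<close>.\<close>

lemma minimal_vertical_normal_constant:
  assumes c: "c = 0" and p: "p \<in> U" and H: "mean_curvature (heis \<tau> \<delta>) F N p = 0"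
  shows "dn1 i p = 0" "dn2 i p = 0"
proof -
  define w where "w i = n1 p * dn2 i p - n2 p * dn1 i p" for i
  have dn: "\<epsilon> * dn1 i p = \<delta> * n2 p * w i" "\<epsilon> * dn2 i p = n1 p * w i" for i
    using vertical_forms[OF c p] by (simp_all add: w_def)
  have "w 1 * zeta 2 p - w 2 * zeta 1 p = n1 p * (dn2 1 p * zeta 2 p - dn2 2 p * zeta 1 p)
      - n2 p * (dn1 1 p * zeta 2 p - dn1 2 p * zeta 1 p)"
    by (simp add: w_def algebra_simps)
  also have "\<dots> = 0" using vertical_mean_curvature[OF c p] H by simp
  finally have wz: "w 1 * zeta 2 p = w 2 * zeta 1 p" by simp
  have sym: "(\<epsilon> * dn1 1 p) * (\<epsilon> * dx 2 p) - (\<epsilon> * dn1 2 p) * (\<epsilon> * dx 1 p)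
      - \<delta> * ((\<epsilon> * dn2 1 p) * (\<epsilon> * dy 2 p) - (\<epsilon> * dn2 2 p) * (\<epsilon> * dy 1 p)) = 0"
    using symmetric_shape[OF p] c \<epsilon> by auto
  have "- \<delta> * \<epsilon> * (w 1 * arc 2 p - w 2 * arc 1 p)
      = - \<delta> * (n1 p * n1 p - \<delta> * (n2 p * n2 p)) * (w 1 * arc 2 p - w 2 * arc 1 p)"
    using unit[OF p] c by simp
  also have "\<dots> = 0"
    using sym unfolding dn vertical_forms(1,2)[OF c p] arc_def[symmetric] by (simp add: algebra_simps)
  finally have wa: "w 1 * arc 2 p = w 2 * arc 1 p" using \<delta> \<epsilon> by auto
  have "w 1 * (arc 1 p * zeta 2 p - arc 2 p * zeta 1 p)
      = arc 1 p * (w 1 * zeta 2 p) - zeta 1 p * (w 1 * arc 2 p)"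
    by (simp add: algebra_simps)
  also have "\<dots> = 0" unfolding wz wa by simp
  finally have "w 1 * (arc 1 p * zeta 2 p - arc 2 p * zeta 1 p) = 0" .
  moreover have "w 2 * (arc 1 p * zeta 2 p - arc 2 p * zeta 1 p)
      = zeta 2 p * (w 2 * arc 1 p) - arc 2 p * (w 2 * zeta 1 p)"
    by (simp add: algebra_simps)
  then have "w 2 * (arc 1 p * zeta 2 p - arc 2 p * zeta 1 p) = 0"
    unfolding wz[symmetric] wa[symmetric] by simp
  ultimately have "w 1 = 0" "w 2 = 0" using arc_zeta_independent[OF c p] by auto
  then have "w i = 0" using exhaust_2[of i] by auto
  then show "dn1 i p = 0" "dn2 i p = 0" using dn[of i] \<epsilon> by auto
qed

text \<open>For \<open>c \<noteq> 0\<close> the surface is transversal to \<open>E\<^sub>3\<close>, hence locally a graph over the \<open>xy\<close>-plane, and \<open>\<zeta>\<close> is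
a combination of \<open>dx\<close> and \<open>dy\<close> on it.\<close>

lemma transversal_dx_dy:
  assumes c: "c \<noteq> 0" and p: "p \<in> U"
  shows "dx 1 p * dy 2 p \<noteq> dx 2 p * dy 1 p"
    and "\<delta> * c * (zeta 1 p * dy 2 p - zeta 2 p * dy 1 p) = - n1 p * (dx 1 p * dy 2 p - dx 2 p * dy 1 p)"
    and "c * (dx 1 p * zeta 2 p - dx 2 p * zeta 1 p) = n2 p * (dx 1 p * dy 2 p - dx 2 p * dy 1 p)"
proof -
  have z: "\<delta> * (c * zeta i p) = \<delta> * (n2 p * dy i p) - n1 p * dx i p" for i
    using normal[OF p, of i] by simp
  have "\<delta> * c * (zeta 1 p * dy 2 p - zeta 2 p * dy 1 p)
      = (\<delta> * (c * zeta 1 p)) * dy 2 p - (\<delta> * (c * zeta 2 p)) * dy 1 p" by (simp add: algebra_simps)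
  then show 1: "\<delta> * c * (zeta 1 p * dy 2 p - zeta 2 p * dy 1 p)
      = - n1 p * (dx 1 p * dy 2 p - dx 2 p * dy 1 p)"
    unfolding z by (simp add: algebra_simps)
  have "\<delta> * (c * (dx 1 p * zeta 2 p - dx 2 p * zeta 1 p))
      = dx 1 p * (\<delta> * (c * zeta 2 p)) - dx 2 p * (\<delta> * (c * zeta 1 p))" by (simp add: algebra_simps)
  also have "\<dots> = \<delta> * (n2 p * (dx 1 p * dy 2 p - dx 2 p * dy 1 p))"
    unfolding z by (simp add: algebra_simps)
  finally show 2: "c * (dx 1 p * zeta 2 p - dx 2 p * zeta 1 p) = n2 p * (dx 1 p * dy 2 p - dx 2 p * dy 1 p)"
    using \<delta> by auto
  show "dx 1 p * dy 2 p \<noteq> dx 2 p * dy 1 p"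
  proof
    assume "dx 1 p * dy 2 p = dx 2 p * dy 1 p"
    then show False using immersion[OF p] 1 2 c \<delta> by (auto simp: mult.commute)
  qed
qed

text \<open>Minimality as \<open>dn1 \<and> dy + dx \<and> dn2 = 0\<close>: the connection terms of the trace formula cancel by
\<open>transversal_dx_dy\<close>.\<close>

lemma transversal_minimal:
  assumes c: "c \<noteq> 0" and p: "p \<in> U" and H: "mean_curvature (heis \<tau> \<delta>) F N p = 0"
  shows "dn1 1 p * dy 2 p - dn1 2 p * dy 1 p + (dx 1 p * dn2 2 p - dx 2 p * dn2 1 p) = 0"
proof -
  have "dn1 1 p * dy 2 p - dn1 2 p * dy 1 p + (dx 1 p * dn2 2 p - dx 2 p * dn2 1 p)
      + \<tau> * (\<delta> * n2 p * (zeta 1 p * dy 2 p - zeta 2 p * dy 1 p)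
        + n1 p * (dx 1 p * zeta 2 p - dx 2 p * zeta 1 p)) = 0"
    using trace[OF p linear_component[of 1] linear_component[of 2]]
    unfolding weingarten[OF p] dF_component[OF p] H by (simp add: algebra_simps)
  moreover have "c * (\<delta> * n2 p * (zeta 1 p * dy 2 p - zeta 2 p * dy 1 p)
        + n1 p * (dx 1 p * zeta 2 p - dx 2 p * zeta 1 p))
      = n2 p * (\<delta> * c * (zeta 1 p * dy 2 p - zeta 2 p * dy 1 p))
        + n1 p * (c * (dx 1 p * zeta 2 p - dx 2 p * zeta 1 p))"
    by (simp add: algebra_simps)
  then have "\<delta> * n2 p * (zeta 1 p * dy 2 p - zeta 2 p * dy 1 p)
        + n1 p * (dx 1 p * zeta 2 p - dx 2 p * zeta 1 p) = 0"
    unfolding transversal_dx_dy(2,3)[OF c p] using c by simp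
  ultimately show ?thesis by simp
qed

text \<open>When the horizontal part of the normal is not null, \<open>dn1\<close> and \<open>dn2\<close> are both determined by the single
form \<open>w = n1 dn2 - n2 dn1\<close>. Symmetry of the shape operator and minimality then are two linear equations
for \<open>P = w \<and> dx\<close> and \<open>Q = w \<and> dy\<close>, which Cramer's rule solves; and \<open>w\<close> is recovered from \<open>P\<close> and \<open>Q\<close>
because \<open>dx\<close> and \<open>dy\<close> are independent.\<close>

lemma transversal_nonnull_normal_rotation:
  assumes c: "c \<noteq> 0" and p: "p \<in> U" and H: "mean_curvature (heis \<tau> \<delta>) F N p = 0"
    and r: "\<epsilon> - \<delta> * (c * c) \<noteq> 0"
  shows "n1 p * dn2 i p - n2 p * dn1 i p = - 2 * \<tau> * c * (n1 p * dx i p - \<delta> * (n2 p * dy i p))"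
proof -
  define w where "w i = n1 p * dn2 i p - n2 p * dn1 i p" for i
  define W where "W = dx 1 p * dy 2 p - dx 2 p * dy 1 p"
  define r where "r = \<epsilon> - \<delta> * (c * c)"
  define P where "P = w 1 * dx 2 p - w 2 * dx 1 p"
  define Q where "Q = w 1 * dy 2 p - w 2 * dy 1 p"
  have r0: "r \<noteq> 0" and W0: "W \<noteq> 0"
    using r transversal_dx_dy[OF c p] by (simp_all add: r_def W_def)
  \<comment> \<open>\<open>dn1\<close> and \<open>dn2\<close> are expressed by \<open>w\<close> before the two equations are solved for \<open>P\<close> and \<open>Q\<close>\<close>
  have rn: "n1 p * n1 p - \<delta> * (n2 p * n2 p) = r" using unit[OF p] by (simp add: r_def)
  have dn: "r * dn1 i p = \<delta> * n2 p * w i" "r * dn2 i p = n1 p * w i" for i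
    using proportional_of_cross_eq_0[OF d_unit[OF p] rn] by (simp_all add: w_def)
  have "r * ((dn1 1 p * dx 2 p - dn1 2 p * dx 1 p) - \<delta> * (dn2 1 p * dy 2 p - dn2 2 p * dy 1 p))
      = ((r * dn1 1 p) * dx 2 p - (r * dn1 2 p) * dx 1 p)
        - \<delta> * ((r * dn2 1 p) * dy 2 p - (r * dn2 2 p) * dy 1 p)"
    by (simp add: algebra_simps)
  also have "\<dots> = \<delta> * (n2 p * P - n1 p * Q)" unfolding dn P_def Q_def by (simp add: algebra_simps)
  finally have "\<delta> * (n2 p * P - n1 p * Q) = \<delta> * (2 * \<tau> * c * r * W)"
    unfolding symmetric_shape[OF p] W_def by (simp add: algebra_simps)
  then have PQ: "n1 p * Q - n2 p * P = - 2 * \<tau> * c * r * W" using \<delta> by auto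
  have "r * (dn1 1 p * dy 2 p - dn1 2 p * dy 1 p + (dx 1 p * dn2 2 p - dx 2 p * dn2 1 p))
      = (r * dn1 1 p) * dy 2 p - (r * dn1 2 p) * dy 1 p + (dx 1 p * (r * dn2 2 p) - dx 2 p * (r * dn2 1 p))"
    by (simp add: algebra_simps)
  also have "\<dots> = \<delta> * (n2 p * Q) - n1 p * P" unfolding dn P_def Q_def by (simp add: algebra_simps)
  finally have "n1 p * P = \<delta> * (n2 p * Q)" using transversal_minimal[OF c p H] by simp
  from proportional_of_cross_eq_0[OF this rn]
  have "r * P = r * (- 2 * \<tau> * c * \<delta> * n2 p * W)" "r * Q = r * (- 2 * \<tau> * c * n1 p * W)"
    unfolding PQ by (simp_all add: mult_ac)
  then have P: "P = - 2 * \<tau> * c * \<delta> * n2 p * W" and Q: "Q = - 2 * \<tau> * c * n1 p * W"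
    using r0 by (simp_all only: mult_cancel_left) simp_all
  \<comment> \<open>expansion of \<open>w\<close> in the basis \<open>dx\<close>, \<open>dy\<close>\<close>
  have "w i * W = dx i p * Q - dy i p * P"
    using exhaust_2[of i] by (auto simp: W_def P_def Q_def algebra_simps)
  also have "\<dots> = (- 2 * \<tau> * c * (n1 p * dx i p - \<delta> * (n2 p * dy i p))) * W"
    unfolding P Q by (simp add: algebra_simps)
  finally show ?thesis unfolding mult_right_cancel[OF W0] by (simp add: w_def)
qed

text \<open>The exterior derivative of \<open>transversal_nonnull_normal_rotation\<close> is contradictory. On the left it is
\<open>2 dn1 \<and> dn2\<close>, which vanishes since \<open>dn1\<close> and \<open>dn2\<close> are proportional. On the right it is, by
\<open>symmetric_shape\<close>, a nonzero multiple of \<open>dx \<and> dy\<close>.\<close>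

lemma minimal_nonnull_imp_vertical:
  assumes "\<tau> \<noteq> 0" and p: "p \<in> U" and H: "\<And>q. q \<in> U \<Longrightarrow> mean_curvature (heis \<tau> \<delta>) F N q = 0"
    and r: "\<epsilon> - \<delta> * (c * c) \<noteq> 0"
  shows "c = 0"
proof (rule ccontr)
  assume c: "c \<noteq> 0"
  define k where "k = - 2 * \<tau> * c"
  have e: "n1 p * partial j (dn2 i) p + dn1 j p * dn2 i p - (n2 p * partial j (dn1 i) p + dn2 j p * dn1 i p)
      = k * (n1 p * partial j (dx i) p + dn1 j p * dx i p
        - \<delta> * (n2 p * partial j (dy i) p + dn2 j p * dy i p))" for i j
  proof -
    have "partial j (\<lambda>q. n1 q * dn2 i q - n2 q * dn1 i q) p
        = partial j (\<lambda>q. k * (n1 q * dx i q - \<delta> * (n2 q * dy i q))) p"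
      unfolding k_def
      by (rule partial_cong[OF U p]) (rule transversal_nonnull_normal_rotation[OF c _ H r])
    then show ?thesis
      using differentiable[OF p] by (simp add: partial_diff partial_mult partial_const)
  qed
  have s: "partial 2 (dx 1) p = partial 1 (dx 2) p" "partial 2 (dy 1) p = partial 1 (dy 2) p"
    "partial 2 (dn1 1) p = partial 1 (dn1 2) p" "partial 2 (dn2 1) p = partial 1 (dn2 2) p"
    using partial_commute[OF smooth_components(1) U p] partial_commute[OF smooth_components(2) U p]
    by auto
  have "2 * (dn1 1 p * dn2 2 p - dn1 2 p * dn2 1 p) =
      k * ((dn1 1 p * dx 2 p - dn1 2 p * dx 1 p) - \<delta> * (dn2 1 p * dy 2 p - dn2 2 p * dy 1 p))"
    using e[of 1 2] e[of 2 1] unfolding s by (simp add: algebra_simps)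
  then have dn: "dn1 1 p * dn2 2 p - dn1 2 p * dn2 1 p \<noteq> 0"
    unfolding symmetric_shape[OF p]
    using c \<open>\<tau> \<noteq> 0\<close> \<delta> transversal_dx_dy(1)[OF c p] by (auto simp: k_def)
  have rn: "n1 p * n1 p - \<delta> * (n2 p * n2 p) = \<epsilon> - \<delta> * (c * c)" using unit[OF p] by simp
  have "(\<epsilon> - \<delta> * (c * c)) * dn1 1 p * ((\<epsilon> - \<delta> * (c * c)) * dn2 2 p)
      = (\<epsilon> - \<delta> * (c * c)) * dn1 2 p * ((\<epsilon> - \<delta> * (c * c)) * dn2 1 p)"
    unfolding proportional_of_cross_eq_0[OF d_unit[OF p] rn] by (simp add: mult_ac)
  then show False using dn r by (simp add: mult_ac)
qed

text \<open>The horizontal part of the normal is null. If \<open>\<delta> = -1\<close> it is zero, the tangent planes are the contact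
planes, and these are not integrable. If \<open>\<delta> = 1\<close> then \<open>dn1 = \<plusminus> dn2\<close>, and symmetry of the shape operator
and minimality prescribe different values for the same 2-form.\<close>

lemma minimal_null_imp_vertical:
  assumes "\<tau> \<noteq> 0" and p: "p \<in> U" and H: "\<And>q. q \<in> U \<Longrightarrow> mean_curvature (heis \<tau> \<delta>) F N q = 0"
    and r: "\<epsilon> - \<delta> * (c * c) = 0"
  shows "c = 0"
proof (rule ccontr)
  assume c: "c \<noteq> 0"
  define W where "W = dx 1 p * dy 2 p - dx 2 p * dy 1 p"
  have W: "W \<noteq> 0" using transversal_dx_dy[OF c p] by (simp add: W_def)
  have nn: "n1 q * n1 q = \<delta> * (n2 q * n2 q)" if "q \<in> U" for q
    using unit[OF that] r by simp
  show False
  proof (cases "\<delta> = 1")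
    case False
    then have d: "\<delta> = -1" using \<delta> by simp
    have "n1 q = 0" "n2 q = 0" if "q \<in> U" for q
      using nn[OF that] sum_squares_eq_zero_iff[of "n1 q" "n2 q"] by (simp_all add: d)
    then have "dn1 i p = partial i (\<lambda>q. 0) p" "dn2 i p = partial i (\<lambda>q. 0) p" for i
      by (auto intro: partial_cong[OF U p])
    then have "dn1 i p = 0" "dn2 i p = 0" for i by (simp_all add: partial_const)
    then show False using symmetric_shape[OF p] W c \<open>\<tau> \<noteq> 0\<close> d by (simp add: W_def)
  next
    case True
    have sq: "(n1 p) ^ 2 = (n2 p) ^ 2" using nn[OF p] True by (simp add: power2_eq_square)
    have "\<exists>s. s * s = 1 \<and> (\<forall>i. dn1 i p = s * dn2 i p)"
    proof (cases "n2 p = 0")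
      case False
      define s where "s = n1 p / n2 p"
      have s: "s * s = 1" "n1 p = s * n2 p"
        using sq False by (simp_all add: s_def power2_eq_square)
      have sn: "n2 p = s * n1 p" using s(1) by (simp add: s(2) mult.assoc[symmetric])
      have "n2 p * dn1 i p = n2 p * (s * dn2 i p)" for i
      proof -
        have "n2 p * dn1 i p = s * (n1 p * dn1 i p)" by (subst sn) (simp only: mult.assoc)
        also have "\<dots> = s * (n2 p * dn2 i p)" using d_unit[OF p, of i] True by simp
        finally show ?thesis by (simp only: mult_ac)
      qed
      then show ?thesis using s(1) False by auto
    next
      case n2: True
      then have n1: "n1 p = 0" using sq by simp
      \<comment> \<open>where \<open>n1\<close> and \<open>n2\<close> vanish, \<open>n1\<^sup>2 = n2\<^sup>2\<close> has to be differentiated twice\<close>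
      have q: "dn1 j p * dn1 i p = dn2 j p * dn2 i p" for i j
      proof -
        have "partial j (\<lambda>q. n1 q * dn1 i q) p = partial j (\<lambda>q. n2 q * dn2 i q) p"
          by (rule partial_cong[OF U p]) (use d_unit True in simp)
        then show ?thesis using differentiable[OF p] n1 n2 by (simp add: partial_mult)
      qed
      show ?thesis
      proof (cases "\<exists>k. dn2 k p \<noteq> 0")
        case True
        then obtain k where k: "dn2 k p \<noteq> 0" by blast
        have "dn1 k p \<noteq> 0" using q[of k k] k by auto
        then have "dn1 i p = dn2 k p / dn1 k p * dn2 i p" for i
          using q[of k i] by (simp add: field_simps)
        moreover have "dn2 k p / dn1 k p * (dn2 k p / dn1 k p) = 1"
          using q[of k k] k by simp
        ultimately show ?thesis by blast
      next
        case False
        then have "dn1 i p = 0" for i using q[of i i] by simp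
        then show ?thesis using False by (intro exI[of _ 1]) simp
      qed
    qed
    then obtain s where s: "s * s = 1" and dn: "\<And>i. dn1 i p = s * dn2 i p" by blast
    define P where "P = dn2 1 p * dx 2 p - dn2 2 p * dx 1 p"
    define Q where "Q = dn2 1 p * dy 2 p - dn2 2 p * dy 1 p"
    have "s * P - Q = 2 * \<tau> * c * W"
      using symmetric_shape[OF p] unfolding dn True P_def Q_def W_def by (simp add: algebra_simps)
    moreover have "P = s * Q"
      using transversal_minimal[OF c p H[OF p]] unfolding dn P_def Q_def by (simp add: algebra_simps)
    then have "Q = s * P" using s by (simp add: mult.assoc[symmetric])
    ultimately show False using c W \<open>\<tau> \<noteq> 0\<close> by simp
  qed
qed

end

section \<open>From charts to the whole surface\<close>

lemma partials_zero_imp_has_derivative_zero: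
  fixes h :: "real^2 \<Rightarrow> real"
  assumes "h differentiable at p" "partial 1 h p = 0" "partial 2 h p = 0"
  shows "(h has_derivative (\<lambda>v. 0)) (at p)"
proof -
  have "frechet_derivative h (at p) = (\<lambda>v. 0)"
    using frechet_derivative_eq_partials[OF assms(1)] assms(2,3) by auto
  then show ?thesis using assms(1) unfolding frechet_derivative_works by simp
qed

lemma connected_space_locally_constant:
  assumes M: "connected_space M" and x0: "x0 \<in> topspace M"
    and loc: "\<And>x. x \<in> topspace M \<Longrightarrow> \<exists>V. openin M V \<and> x \<in> V \<and> (\<forall>y\<in>V. h y = h x)"
  shows "\<forall>x\<in>topspace M. h x = h x0"
proof -
  have op: "openin M {x \<in> topspace M. h x \<in> S}" for S
  proof (subst openin_subopen, intro ballI)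
    fix x assume x: "x \<in> {x \<in> topspace M. h x \<in> S}"
    then obtain V where V: "openin M V" "x \<in> V" "\<forall>y\<in>V. h y = h x" using loc[of x] by blast
    have "V \<subseteq> {x \<in> topspace M. h x \<in> S}"
    proof
      fix y assume y: "y \<in> V"
      have "h y = h x" using V(3) y ..
      then show "y \<in> {x \<in> topspace M. h x \<in> S}" using x openin_subset[OF V(1)] y by auto
    qed
    then show "\<exists>T. openin M T \<and> x \<in> T \<and> T \<subseteq> {x \<in> topspace M. h x \<in> S}" using V by blast
  qed
  define T where "T = {x \<in> topspace M. h x \<in> {h x0}}"
  have "topspace M - T = {x \<in> topspace M. h x \<in> - {h x0}}" by (auto simp: T_def)
  then have "openin M (topspace M - T)" using op by (simp only:)
  then have "closedin M T" unfolding closedin_def by (auto simp: T_def)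
  then have "T = {} \<or> T = topspace M"
    using M op[of "{h x0}"] unfolding connected_space_clopen_in T_def by blast
  then show ?thesis using x0 by (auto simp: T_def)
qed

lemma chart_image_open:
  assumes "smooth_surface M A" "(U, \<phi>) \<in> A" "open B" "B \<subseteq> U"
  shows "openin M (\<phi> ` B)"
proof -
  have emb: "embedding_map (top_of_set U) M \<phi>" and oU: "openin M (\<phi> ` U)"
    using assms(1,2) by (auto simp: smooth_surface_def)
  have "open_map (top_of_set U) (subtopology M (\<phi> ` U)) \<phi>"
    using emb by (simp add: embedding_map_def homeomorphic_imp_open_map)
  moreover have "openin (top_of_set U) B" using assms(3,4) by (metis inf.absorb_iff2 openin_open)
  ultimately have "openin (subtopology M (\<phi> ` U)) (\<phi> ` B)" by (simp add: open_map_def)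
  then show ?thesis using oU by (rule openin_trans_full)
qed

lemma chart_point:
  assumes "smooth_surface M A" "(U, \<phi>) \<in> A" "p \<in> U"
  shows "\<phi> p \<in> topspace M"
  using assms by (force simp: smooth_surface_def)

lemma chart_cover:
  assumes "smooth_surface M A" "x \<in> topspace M"
  obtains U \<phi> p where "(U, \<phi>) \<in> A" "p \<in> U" "x = \<phi> p"
proof -
  have "x \<in> (\<Union>(U, \<phi>)\<in>A. \<phi> ` U)" using assms by (simp add: smooth_surface_def)
  then show ?thesis using that by auto
qed

lemma chart_open: "smooth_surface M A \<Longrightarrow> (U, \<phi>) \<in> A \<Longrightarrow> open U"
  by (auto simp: smooth_surface_def)

text \<open>A function with vanishing derivative in every chart is locally constant, and a locally constant
function on a connected space is constant.\<close>

lemma connected_surface_constant: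
  fixes h :: "'m \<Rightarrow> real"
  assumes M: "smooth_surface M A" "connected_space M" and x0: "x0 \<in> topspace M"
    and d: "\<And>U \<phi> p. (U, \<phi>) \<in> A \<Longrightarrow> p \<in> U \<Longrightarrow> ((\<lambda>q. h (\<phi> q)) has_derivative (\<lambda>v. 0)) (at p)"
  shows "\<forall>x\<in>topspace M. h x = h x0"
proof (rule connected_space_locally_constant[OF M(2) x0])
  fix x assume "x \<in> topspace M"
  then obtain U \<phi> p where ch: "(U, \<phi>) \<in> A" "p \<in> U" "x = \<phi> p" using chart_cover[OF M(1)] by metis
  obtain r where r: "r > 0" "ball p r \<subseteq> U"
    using chart_open[OF M(1) ch(1)] ch(2) open_contains_ball by blast
  have "\<exists>k. \<forall>q\<in>ball p r. h (\<phi> q) = k"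
    using has_derivative_at_withinI[OF d[OF ch(1)]] r
    by (intro has_derivative_zero_constant) (auto simp: subset_iff)
  then obtain k where k: "\<forall>q\<in>ball p r. h (\<phi> q) = k" by blast
  have "h x = k" unfolding ch(3) using bspec[OF k, of p] r(1) by simp
  then have "\<forall>y\<in>\<phi> ` ball p r. h y = h x" using k by blast
  moreover have "openin M (\<phi> ` ball p r)" by (rule chart_image_open[OF M(1) ch(1) open_ball r(2)])
  moreover have "x \<in> \<phi> ` ball p r" unfolding ch(3) using r(1) by (intro imageI) simp
  ultimately show "\<exists>V. openin M V \<and> x \<in> V \<and> (\<forall>y\<in>V. h y = h x)" by blast
qed

lemma immersed_surface_helix_chart:
  assumes im: "immersed_surface (heis \<tau> \<delta>) \<epsilon> M A f N" and "\<delta> \<in> {1, -1}"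
    and c: "\<And>x. x \<in> topspace M \<Longrightarrow> heis_form \<tau> (f x) (N x) = c" and ch: "(U, \<phi>) \<in> A"
  shows "helix_chart \<tau> \<delta> \<epsilon> c U (f \<circ> \<phi>) (N \<circ> \<phi>)"
proof -
  have sm: "smooth_surface M A" using im by (simp add: immersed_surface_def)
  show ?thesis
    using im ch chart_point[OF sm ch] chart_open[OF sm ch] c assms(2)
    unfolding immersed_surface_def helix_chart_def by auto
qed

text \<open>Sussmann's open mapping theorem asks for a right inverse of the derivative at each point. An injective
endomorphism of the plane is surjective and has one.\<close>

lemma open_image_of_immersion:
  fixes G :: "real^2 \<Rightarrow> real^2"
  assumes U: "open U" and d: "\<And>p. p \<in> U \<Longrightarrow> (G has_derivative G' p) (at p)"
    and inj: "\<And>p. p \<in> U \<Longrightarrow> inj (G' p)"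
  shows "open (G ` U)"
proof -
  have cont: "continuous_on U G"
    using d by (meson continuous_at_imp_continuous_on has_derivative_continuous)
  have "G p \<in> interior (G ` U)" if p: "p \<in> U" for p
  proof -
    have lin: "linear (G' p)" using d[OF p] by (rule has_derivative_linear)
    then have "surj (G' p)" using linear_injective_imp_surjective inj[OF p] by blast
    then obtain g where g: "linear g" "G' p \<circ> g = id" using linear_surjective_right_inverse lin by blast
    show ?thesis
      using sussmann_open_mapping[OF U cont p d[OF p] _ g(2) subset_refl] g(1) p U
      by (simp add: interior_open linear_conv_bounded_linear)
  qed
  then show ?thesis by (metis (no_types, lifting) image_subsetI interior_subset open_interior subset_antisym)
qed

text \<open>Left translation of the Heisenberg group by \<open>(a, b, 0)\<close>.\<close>

definition heis_translation :: "real \<Rightarrow> real \<Rightarrow> real \<Rightarrow> real^3 \<Rightarrow> real^3" where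
  "heis_translation \<tau> a b p = vector [p $ 1 + a, p $ 2 + b, p $ 3 - \<tau> * (b * p $ 1 - a * p $ 2)]"

lemma has_derivative_affine:
  fixes L :: "'a::euclidean_space \<Rightarrow> 'b::euclidean_space"
  assumes "linear L" and "\<And>p. f p = L p + k"
  shows "(f has_derivative L) (at p)"
proof -
  have "((\<lambda>p. L p + k) has_derivative L) (at p)"
    using bounded_linear_imp_has_derivative[OF assms(1)[unfolded linear_conv_bounded_linear]]
    by (rule has_derivative_add_const)
  moreover have "f = (\<lambda>p. L p + k)" using assms(2) by auto
  ultimately show ?thesis by simp
qed

lemma heis_translation_has_derivative:
  "(heis_translation \<tau> a b has_derivative
     (\<lambda>v. vector [v $ 1, v $ 2, v $ 3 - \<tau> * (b * v $ 1 - a * v $ 2)])) (at p)"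
  by (rule has_derivative_affine[where k = "vector [a, b, 0]"])
     (auto intro!: linearI simp: heis_translation_def vec_eq_iff forall_3 algebra_simps)

lemma heis_translation_inverse: "heis_translation \<tau> (- a) (- b) (heis_translation \<tau> a b p) = p"
  by (simp add: heis_translation_def vec_eq_iff forall_3 algebra_simps)

text \<open>Left translations preserve \<open>dx\<close>, \<open>dy\<close> and the contact form, hence the metric.\<close>

lemma is_isometry_heis_translation: "is_isometry (heis \<tau> \<delta>) (heis_translation \<tau> a b)"
proof -
  have i: "heis_translation \<tau> a b (heis_translation \<tau> (- a) (- b) p) = p" for p
    using heis_translation_inverse[of \<tau> "- a" "- b"] by simp
  have inv: "inv (heis_translation \<tau> a b) = heis_translation \<tau> (- a) (- b)"
    using i heis_translation_inverse by (intro inv_unique_comp) auto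
  have "bij (heis_translation \<tau> a b)"
    using i heis_translation_inverse by (metis bijI')
  moreover have "smooth_on UNIV (heis_translation \<tau> a b)" for a b
    by (rule smooth_on_constant_derivative[OF open_UNIV heis_translation_has_derivative])
  moreover have "frechet_derivative (heis_translation \<tau> a b) (at p)
      = (\<lambda>v. vector [v $ 1, v $ 2, v $ 3 - \<tau> * (b * v $ 1 - a * v $ 2)])" for p
    using frechet_derivative_at[OF heis_translation_has_derivative] by metis
  moreover have "heis_form \<tau> (heis_translation \<tau> a b p)
      (vector [v $ 1, v $ 2, v $ 3 - \<tau> * (b * v $ 1 - a * v $ 2)]) = heis_form \<tau> p v" for p v
    by (simp add: heis_form_def heis_translation_def algebra_simps)
  ultimately show ?thesis
    unfolding is_isometry_def inv by (simp add: heis_def)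
qed

text \<open>The factor \<open>s\<close> allows the vector \<open>(n1, n2)\<close> that describes the plane to be rescaled against the
normal: to bring it into the form of a hyperbolic angle, its sign may have to be changed.\<close>

lemma vertical_plane_open_part:
  assumes im: "immersed_surface (heis \<tau> \<delta>) \<epsilon> M A f N"
    and angle: "\<And>x. x \<in> topspace M \<Longrightarrow> heis_form \<tau> (f x) (N x) = 0"
    and n: "\<And>x. x \<in> topspace M \<Longrightarrow> N x $ 1 = s * n1" "\<And>x. x \<in> topspace M \<Longrightarrow> N x $ 2 = s * n2"
    and s: "s \<noteq> 0"
    and k: "\<And>x. x \<in> topspace M \<Longrightarrow> n1 * f x $ 1 = \<delta> * (n2 * f x $ 2) + k"
    and u: "n1 * n1 - \<delta> * (n2 * n2) = \<epsilon>"
  shows "open_part_up_to_isometry (heis \<tau> \<delta>) M f (\<lambda>p. vector [\<delta> * n2 * p $ 2, n1 * p $ 2, p $ 1])"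
proof -
  have \<epsilon>: "\<epsilon> * \<epsilon> = 1" and sm: "smooth_surface M A" using im by (auto simp: immersed_surface_def)
  \<comment> \<open>the translation by \<open>(a, b)\<close> moves the plane to the origin because \<open>n1\<^sup>2 - \<delta> n2\<^sup>2 = \<epsilon>\<close> and \<open>\<epsilon>\<^sup>2 = 1\<close>\<close>
  define a b where "a = - \<epsilon> * k * n1" and "b = - \<epsilon> * k * n2"
  define \<Phi> where "\<Phi> = heis_translation \<tau> a b"
  \<comment> \<open>\<open>P\<close> inverts the parametrization \<open>F\<close> of the plane; \<open>K\<close> is the linear part of \<open>P \<circ> \<Phi>\<close>\<close>
  define P :: "real^3 \<Rightarrow> real^2" where "P q = vector [q $ 3, \<epsilon> * (n1 * q $ 2 - n2 * q $ 1)]" for q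
  define F where "F p = (vector [\<delta> * n2 * p $ 2, n1 * p $ 2, p $ 1] :: real^3)" for p :: "real^2"
  define K :: "real^3 \<Rightarrow> real^2" where
    "K v = vector [v $ 3 - \<tau> * (b * v $ 1 - a * v $ 2), \<epsilon> * (n1 * v $ 2 - n2 * v $ 1)]" for v
  define W where "W = P ` (\<Phi> \<circ> f) ` topspace M"
  have FP: "F (P q) = q" if "n1 * q $ 1 = \<delta> * (n2 * q $ 2)" for q
  proof -
    have "\<epsilon> * (\<epsilon> * q $ i) = q $ i" for i by (simp add: \<epsilon> mult.assoc[symmetric])
    then have "\<delta> * n2 * (\<epsilon> * (n1 * q $ 2 - n2 * q $ 1)) = q $ 1" "n1 * (\<epsilon> * (n1 * q $ 2 - n2 * q $ 1)) = q $ 2"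
      using proportional_of_cross_eq_0[OF that u] by (metis mult.left_commute)+
    then show ?thesis by (simp add: F_def P_def vec_eq_iff forall_3)
  qed
  have ab: "n1 * a - \<delta> * (n2 * b) = - k"
  proof -
    have "n1 * a - \<delta> * (n2 * b) = - \<epsilon> * k * (n1 * n1 - \<delta> * (n2 * n2))"
      by (simp add: a_def b_def algebra_simps)
    then show ?thesis using \<epsilon> by (simp add: u)
  qed
  have "n1 * \<Phi> (f x) $ 1 = \<delta> * (n2 * \<Phi> (f x) $ 2)" if "x \<in> topspace M" for x
    using k[OF that] ab by (simp add: \<Phi>_def heis_translation_def algebra_simps)
  then have "F ` W = (\<Phi> \<circ> f) ` topspace M"
    unfolding W_def image_image using FP by (auto simp: image_iff)
  moreover have "open W"
  proof -
    have "W = (\<Union>(U, \<phi>)\<in>A. (\<lambda>q. P (\<Phi> (f (\<phi> q)))) ` U)"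
    proof (intro equalityI subsetI)
      fix w assume "w \<in> W"
      then obtain x where x: "x \<in> topspace M" "w = P (\<Phi> (f x))" by (auto simp: W_def)
      then obtain U \<phi> q where "(U, \<phi>) \<in> A" "q \<in> U" "x = \<phi> q" using chart_cover[OF sm] by metis
      then show "w \<in> (\<Union>(U, \<phi>)\<in>A. (\<lambda>q. P (\<Phi> (f (\<phi> q)))) ` U)" using x by blast
    qed (use chart_point[OF sm] in \<open>auto simp: W_def\<close>)
    moreover have "open ((\<lambda>q. P (\<Phi> (f (\<phi> q)))) ` U)" if ch: "(U, \<phi>) \<in> A" for U \<phi>
    proof (rule open_image_of_immersion[OF chart_open[OF sm ch]])
      fix p assume p: "p \<in> U"
      have sf: "smooth_on U (f \<circ> \<phi>)" and inj: "inj (frechet_derivative (f \<circ> \<phi>) (at p))"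
        and orth: "\<And>v. heis \<tau> \<delta> (f (\<phi> p)) (N (\<phi> p)) (frechet_derivative (f \<circ> \<phi>) (at p) v) = 0"
        using im ch p by (auto simp: immersed_surface_def)
      have df: "((\<lambda>q. f (\<phi> q)) has_derivative frechet_derivative (f \<circ> \<phi>) (at p)) (at p)"
        using smooth_on_differentiable[OF sf chart_open[OF sm ch] p]
        by (simp add: frechet_derivative_works comp_def)
      have linK: "linear K"
        by (rule linearI) (simp_all add: K_def vec_eq_iff forall_2 algebra_simps)
      have "((\<lambda>q. P (\<Phi> q)) has_derivative K) (at r)" for r
        by (rule has_derivative_affine[OF linK, where k = "vector [0, \<epsilon> * (n1 * b - n2 * a)]"])
           (simp add: K_def P_def \<Phi>_def heis_translation_def vec_eq_iff forall_2 algebra_simps)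
      then show "((\<lambda>q. P (\<Phi> (f (\<phi> q)))) has_derivative
          (\<lambda>v. K (frechet_derivative (f \<circ> \<phi>) (at p) v))) (at p)"
        by (rule has_derivative_compose[OF df])
      have lin: "linear (frechet_derivative (f \<circ> \<phi>) (at p))" using df by (rule has_derivative_linear)
      have K0: "w = 0" if w: "n1 * w $ 1 = \<delta> * (n2 * w $ 2)" "K w = 0" for w
      proof -
        have e: "n1 * w $ 2 - n2 * w $ 1 = 0"
          using arg_cong[OF w(2), of "\<lambda>v. v $ 2"] \<epsilon> by (auto simp: K_def)
        have "w $ 1 = 0" "w $ 2 = 0"
          using proportional_of_cross_eq_0[OF w(1) u] \<epsilon> unfolding e by auto
        moreover from this have "w $ 3 = 0"
          using arg_cong[OF w(2), of "\<lambda>v. v $ 1"] by (simp add: K_def)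
        ultimately show ?thesis by (simp add: vec_eq_iff forall_3)
      qed
      have tangent: "n1 * frechet_derivative (f \<circ> \<phi>) (at p) v $ 1
          = \<delta> * (n2 * frechet_derivative (f \<circ> \<phi>) (at p) v $ 2)" for v
      proof -
        have "s * (n1 * frechet_derivative (f \<circ> \<phi>) (at p) v $ 1
            - \<delta> * (n2 * frechet_derivative (f \<circ> \<phi>) (at p) v $ 2)) = 0"
          using orth[of v] n angle chart_point[OF sm ch p] by (simp add: heis_def algebra_simps)
        then show ?thesis using s by simp
      qed
      have "v = 0" if "K (frechet_derivative (f \<circ> \<phi>) (at p) v) = 0" for v
        using K0[OF tangent that] lin inj linear_injective_0 by blast
      moreover have "linear (\<lambda>v. K (frechet_derivative (f \<circ> \<phi>) (at p) v))"
        using linear_compose[OF lin linK] by (simp add: comp_def)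
      ultimately show "inj (\<lambda>v. K (frechet_derivative (f \<circ> \<phi>) (at p) v))"
        using linear_injective_0 by blast
    qed
    ultimately show ?thesis by auto
  qed
  ultimately show ?thesis
    unfolding open_part_up_to_isometry_def
    by (intro exI[of _ \<Phi>] exI[of _ W]) (simp add: \<Phi>_def F_def[abs_def] is_isometry_heis_translation)
qed

lemma heis_E3: "heis \<tau> \<delta> p v E3 = \<delta> * heis_form \<tau> p v"
proof -
  have "heis_form \<tau> p E3 = 1" by (simp add: heis_form_def E3_def)
  then show ?thesis by (simp add: heis_def E3_def)
qed

lemma minimal_helix_surface_vertical:
  assumes \<tau>: "\<tau> \<noteq> 0" and \<delta>: "\<delta> \<in> {1, -1}"
    and im: "immersed_surface (heis \<tau> \<delta>) \<epsilon> M A f N" and ne: "topspace M \<noteq> {}"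
    and ca: "constant_angle_surface (heis \<tau> \<delta>) \<epsilon> M f N"
    and min: "minimal_surface (heis \<tau> \<delta>) A f N"
  shows "\<forall>x\<in>topspace M. heis_form \<tau> (f x) (N x) = 0"
proof -
  have sm: "smooth_surface M A" and \<epsilon>: "\<epsilon> \<in> {1, -1}" using im by (auto simp: immersed_surface_def)
  obtain \<nu> where "\<And>x. x \<in> topspace M \<Longrightarrow> \<epsilon> * heis \<tau> \<delta> (f x) (N x) E3 = \<nu>"
    using ca by (auto simp: constant_angle_surface_def)
  then have "\<epsilon> * (\<delta> * heis_form \<tau> (f x) (N x)) = \<nu>" if "x \<in> topspace M" for x
    using that by (simp add: heis_E3)
  then have "heis_form \<tau> (f x) (N x) = \<delta> * (\<epsilon> * \<nu>)" if "x \<in> topspace M" for x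
    using that \<delta> \<epsilon> by fastforce
  then obtain c where c: "\<And>x. x \<in> topspace M \<Longrightarrow> heis_form \<tau> (f x) (N x) = c" by blast
  obtain x where "x \<in> topspace M" using ne by blast
  then obtain U \<phi> p where ch: "(U, \<phi>) \<in> A" "p \<in> U" using chart_cover[OF sm] by metis
  interpret helix_chart \<tau> \<delta> \<epsilon> c U "f \<circ> \<phi>" "N \<circ> \<phi>"
    by (rule immersed_surface_helix_chart[OF im \<delta> c ch(1)])
  have "\<And>q. q \<in> U \<Longrightarrow> mean_curvature (heis \<tau> \<delta>) (f \<circ> \<phi>) (N \<circ> \<phi>) q = 0"
    using min ch by (auto simp: minimal_surface_def)
  then have "c = 0"
    using minimal_nonnull_imp_vertical[OF \<tau> ch(2)] minimal_null_imp_vertical[OF \<tau> ch(2)] by blast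
  then show ?thesis using c by blast
qed

lemma vertical_surface_flat:
  assumes "\<delta> \<in> {1, -1}" "immersed_surface (heis \<tau> \<delta>) \<epsilon> M A f N"
    and "\<And>x. x \<in> topspace M \<Longrightarrow> heis_form \<tau> (f x) (N x) = 0"
  shows "flat_surface (heis \<tau> \<delta>) A f"
proof -
  have "gaussian_curvature (induced_metric (heis \<tau> \<delta>) (f \<circ> \<phi>)) p = 0"
    if "(U, \<phi>) \<in> A" "p \<in> U" for U \<phi> p
    by (rule helix_chart.vertical_flat[OF immersed_surface_helix_chart[OF assms(2,1,3) that(1)] refl that(2)])
  then show ?thesis by (auto simp: flat_surface_def)
qed

lemma minimal_helix_surface_plane:
  assumes \<tau>: "\<tau> \<noteq> 0" and \<delta>: "\<delta> \<in> {1, -1}"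
    and im: "immersed_surface (heis \<tau> \<delta>) \<epsilon> M A f N" and ne: "topspace M \<noteq> {}"
    and con: "connected_space M"
    and vert: "\<And>x. x \<in> topspace M \<Longrightarrow> heis_form \<tau> (f x) (N x) = 0"
    and min: "minimal_surface (heis \<tau> \<delta>) A f N"
  shows "\<exists>n1 n2 k. (\<forall>x\<in>topspace M. N x $ 1 = n1 \<and> N x $ 2 = n2
      \<and> n1 * f x $ 1 = \<delta> * (n2 * f x $ 2) + k) \<and> n1 * n1 - \<delta> * (n2 * n2) = \<epsilon>"
proof -
  have sm: "smooth_surface M A" using im by (auto simp: immersed_surface_def)
  obtain x0 where x0: "x0 \<in> topspace M" using ne by blast
  have hc: "helix_chart \<tau> \<delta> \<epsilon> 0 U (f \<circ> \<phi>) (N \<circ> \<phi>)" if "(U, \<phi>) \<in> A" for U \<phi>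
    by (rule immersed_surface_helix_chart[OF im \<delta> vert that])
  have dn: "((\<lambda>q. N (\<phi> q) $ j) has_derivative (\<lambda>v. 0)) (at p)"
    if ch: "(U, \<phi>) \<in> A" "p \<in> U" and j: "j \<in> {1, 2}" for U \<phi> p j
  proof -
    interpret helix_chart \<tau> \<delta> \<epsilon> 0 U "f \<circ> \<phi>" "N \<circ> \<phi>" by (rule hc[OF ch(1)])
    have "mean_curvature (heis \<tau> \<delta>) (f \<circ> \<phi>) (N \<circ> \<phi>) p = 0"
      using min ch by (auto simp: minimal_surface_def)
    from minimal_vertical_normal_constant[OF refl ch(2) this]
    have "partial i (\<lambda>q. (N \<circ> \<phi>) q $ j) p = 0" for i using j by auto
    then have "((\<lambda>q. (N \<circ> \<phi>) q $ j) has_derivative (\<lambda>v. 0)) (at p)"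
      using differentiable(2)[OF ch(2)] by (intro partials_zero_imp_has_derivative_zero)
    then show ?thesis by simp
  qed
  define n1 n2 where "n1 = N x0 $ 1" and "n2 = N x0 $ 2"
  \<comment> \<open>in every chart the derivatives vanish, and \<open>M\<close> is connected\<close>
  have n1: "\<forall>x\<in>topspace M. N x $ 1 = n1"
    unfolding n1_def by (rule connected_surface_constant[OF sm con x0]) (auto intro: dn)
  have n2: "\<forall>x\<in>topspace M. N x $ 2 = n2"
    unfolding n2_def by (rule connected_surface_constant[OF sm con x0]) (auto intro: dn)
  define h where "h x = n1 * f x $ 1 - \<delta> * (n2 * f x $ 2)" for x
  have "\<forall>x\<in>topspace M. h x = h x0"
  proof (rule connected_surface_constant[OF sm con x0])
    fix U \<phi> p assume ch: "(U, \<phi>) \<in> A" "p \<in> U"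
    interpret helix_chart \<tau> \<delta> \<epsilon> 0 U "f \<circ> \<phi>" "N \<circ> \<phi>" by (rule hc[OF ch(1)])
    have N: "(N \<circ> \<phi>) p $ 1 = n1" "(N \<circ> \<phi>) p $ 2 = n2"
      using n1 n2 chart_point[OF sm ch] by auto
    have "(\<lambda>q. n1 * (f \<circ> \<phi>) q $ 1 - \<delta> * (n2 * (f \<circ> \<phi>) q $ 2)) differentiable at p"
      using differentiable(1)[OF ch(2)] by simp
    moreover have "partial i (\<lambda>q. n1 * (f \<circ> \<phi>) q $ 1 - \<delta> * (n2 * (f \<circ> \<phi>) q $ 2)) p = 0" for i
      using normal[OF ch(2), of i] differentiable(1)[OF ch(2)] unfolding N
      by (simp add: partial_diff partial_mult partial_const)
    ultimately have "((\<lambda>q. n1 * (f \<circ> \<phi>) q $ 1 - \<delta> * (n2 * (f \<circ> \<phi>) q $ 2))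
        has_derivative (\<lambda>v. 0)) (at p)"
      by (intro partials_zero_imp_has_derivative_zero)
    then show "((\<lambda>q. h (\<phi> q)) has_derivative (\<lambda>v. 0)) (at p)" by (simp add: h_def)
  qed
  then have k: "\<forall>x\<in>topspace M. n1 * f x $ 1 = \<delta> * (n2 * f x $ 2) + h x0"
    unfolding h_def by (simp add: diff_eq_eq add.commute)
  have "n1 * n1 - \<delta> * (n2 * n2) = \<epsilon>"
    using im x0 vert[OF x0] by (auto simp: immersed_surface_def heis_def n1_def n2_def)
  moreover have "\<forall>x\<in>topspace M. N x $ 1 = n1 \<and> N x $ 2 = n2
      \<and> n1 * f x $ 1 = \<delta> * (n2 * f x $ 2) + h x0"
    using bspec[OF n1] bspec[OF n2] bspec[OF k] by (intro ballI conjI)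
  ultimately show ?thesis
    by (intro exI[of _ n1] exI[of _ n2] exI[of _ "h x0"] conjI)
qed

text \<open>The three normal forms of the classification are instances of one: they are obtained by writing
\<open>(n1, n2)\<close>, up to the sign \<open>s\<close>, by means of an angle.\<close>

theorem minimal_constant_angle_classification:
  fixes \<tau> \<delta> \<epsilon> :: real
  assumes \<tau>: "\<tau> \<noteq> 0" and \<delta>: "\<delta> \<in> {1, -1}"
    and im: "immersed_surface (heis \<tau> \<delta>) \<epsilon> M A f N" and con: "connected_space M"
    and ne: "topspace M \<noteq> {}" and ca: "constant_angle_surface (heis \<tau> \<delta>) \<epsilon> M f N"
    and min: "minimal_surface (heis \<tau> \<delta>) A f N"
  shows "flat_surface (heis \<tau> \<delta>) A f"
    and "\<exists>n1 n2. n1 * n1 - \<delta> * (n2 * n2) = \<epsilon> \<and> (\<forall>s\<in>{1, -1}. open_part_up_to_isometry (heis \<tau> \<delta>) M f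
       (\<lambda>p. vector [\<delta> * (s * n2) * p $ 2, (s * n1) * p $ 2, p $ 1]))"
proof -
  have vert: "heis_form \<tau> (f x) (N x) = 0" if "x \<in> topspace M" for x
    using minimal_helix_surface_vertical[OF \<tau> \<delta> im ne ca min] that by blast
  show "flat_surface (heis \<tau> \<delta>) A f" by (rule vertical_surface_flat[OF \<delta> im vert])
  obtain n1 n2 k where
    plane: "\<forall>x\<in>topspace M. N x $ 1 = n1 \<and> N x $ 2 = n2 \<and> n1 * f x $ 1 = \<delta> * (n2 * f x $ 2) + k"
    and unit: "n1 * n1 - \<delta> * (n2 * n2) = \<epsilon>"
    using minimal_helix_surface_plane[OF \<tau> \<delta> im ne con vert min] by blast
  have "open_part_up_to_isometry (heis \<tau> \<delta>) M f
      (\<lambda>p. vector [\<delta> * (s * n2) * p $ 2, (s * n1) * p $ 2, p $ 1])" if s: "s \<in> {1, -1}" for s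
  proof (rule vertical_plane_open_part[OF im vert, where s = s and k = "s * k"])
    show "s * n1 * (s * n1) - \<delta> * (s * n2 * (s * n2)) = \<epsilon>" using s unit by auto
    fix x assume x: "x \<in> topspace M"
    show "N x $ 1 = s * (s * n1)" "N x $ 2 = s * (s * n2)" using bspec[OF plane x] s by auto
    show "s * n1 * f x $ 1 = \<delta> * (s * n2 * f x $ 2) + s * k" using bspec[OF plane x] s by auto
  qed (use s in auto)
  then show "\<exists>n1 n2. n1 * n1 - \<delta> * (n2 * n2) = \<epsilon> \<and> (\<forall>s\<in>{1, -1}. open_part_up_to_isometry (heis \<tau> \<delta>) M f
       (\<lambda>p. vector [\<delta> * (s * n2) * p $ 2, (s * n1) * p $ 2, p $ 1]))"
    using unit by blast
qed

section \<open>Vertical cylinders of constant mean curvature\<close>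

lemma second_countable_euclidean:
  "second_countable (euclidean :: 'a::second_countable_topology topology)"
proof -
  obtain B :: "'a set set" where B: "countable B" "\<And>C. C \<in> B \<Longrightarrow> open C"
    "\<And>S. open S \<Longrightarrow> \<exists>U. U \<subseteq> B \<and> S = \<Union>U"
    using univ_second_countable by blast
  have "\<exists>V\<in>B. x \<in> V \<and> V \<subseteq> S" if "open S" "x \<in> S" for S x
    using B(3)[OF that(1)] that(2) by blast
  then show ?thesis
    unfolding second_countable_def using B(1,2) by (intro exI[of _ B]) (auto simp: open_openin[symmetric])
qed

text \<open>The vertical cylinder over the plane curve \<open>(a, b)\<close>, in coordinates in which the induced metric has
constant coefficients when the curve is an orbit of (hyperbolic) rotations.\<close>

definition cylinder :: "real \<Rightarrow> real \<Rightarrow> (real \<Rightarrow> real) \<Rightarrow> (real \<Rightarrow> real) \<Rightarrow> real^2 \<Rightarrow> real^3" where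
  "cylinder \<tau> \<epsilon> a b p = vector [a (p $ 2), b (p $ 2), p $ 1 - \<epsilon> * \<tau> * p $ 2]"

text \<open>The three base curves are the unit circle and the two unit hyperbolas. The assumption \<open>shift\<close> says that
the curve is homogeneous: parameters with the same image differ by a period. It makes every coordinate
change between two injective restrictions of the cylinder a local translation. The assumption
\<open>local_section\<close> provides a continuous local choice of the parameter as a function of the point; it
replaces a global inverse, which the circle does not have.\<close>

locale vertical_cylinder =
  fixes \<delta> \<epsilon> :: real and a b :: "real \<Rightarrow> real"
  assumes \<delta>: "\<delta> \<in> {1, -1}" and \<epsilon>: "\<epsilon> \<in> {1, -1}"
    and da: "\<And>v. (a has_real_derivative \<delta> * b v) (at v)"
    and db: "\<And>v. (b has_real_derivative a v) (at v)"
    and unit: "\<And>v. a v * a v - \<delta> * (b v * b v) = \<epsilon>"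
    and shift: "\<And>v w h. a v = a w \<Longrightarrow> b v = b w \<Longrightarrow> a (v + h) = a (w + h) \<and> b (v + h) = b (w + h)"
    and local_section: "\<And>v0. \<exists>r>0. \<exists>T g. open T \<and> continuous_on T g
      \<and> (\<forall>v. \<bar>v - v0\<bar> < r \<longrightarrow> (a v, b v) \<in> T \<and> g (a v, b v) = v)
      \<and> (\<forall>v. (a v, b v) \<in> T \<longrightarrow> a (g (a v, b v)) = a v \<and> b (g (a v, b v)) = b v)"
begin

context
  fixes \<tau> :: real
begin

abbreviation F :: "real^2 \<Rightarrow> real^3" where
  "F \<equiv> cylinder \<tau> \<epsilon> a b"

lemmas F_def = cylinder_def

text \<open>The horizontal lift of the position vector field of the plane, which is orthogonal to the unit circle and
to the unit hyperbolas.\<close>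

definition N :: "real^3 \<Rightarrow> real^3" where
  "N q = vector [q $ 1, q $ 2, 0]"

text \<open>The class of functions is closed under differentiation in a fixed direction, which is why smoothness
follows by induction.\<close>

lemma curve_combination_has_derivative:
  fixes \<alpha> \<beta> \<gamma>1 \<gamma>2 \<kappa> :: "'b::real_normed_vector"
  shows "((\<lambda>p::real^2. a (p $ 2) *\<^sub>R \<alpha> + b (p $ 2) *\<^sub>R \<beta> + (p $ 1 *\<^sub>R \<gamma>1 + p $ 2 *\<^sub>R \<gamma>2) + \<kappa>)
    has_derivative (\<lambda>w. a (p $ 2) *\<^sub>R (w $ 2 *\<^sub>R \<beta>) + b (p $ 2) *\<^sub>R ((\<delta> * w $ 2) *\<^sub>R \<alpha>)
      + (w $ 1 *\<^sub>R \<gamma>1 + w $ 2 *\<^sub>R \<gamma>2))) (at p)"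
proof -
  have c: "((\<lambda>p. p $ k) has_derivative (\<lambda>w. w $ k)) (at p)" for k and p :: "real^2"
    by (rule bounded_linear_imp_has_derivative[OF bounded_linear_vec_nth])
  have "((\<lambda>p. a (p $ 2)) has_derivative (\<lambda>w. \<delta> * b (p $ 2) * w $ 2)) (at p)"
    using has_derivative_compose[OF c da[of "p $ 2", unfolded has_field_derivative_def]] by simp
  moreover have "((\<lambda>p. b (p $ 2)) has_derivative (\<lambda>w. a (p $ 2) * w $ 2)) (at p)"
    using has_derivative_compose[OF c db[of "p $ 2", unfolded has_field_derivative_def]] by simp
  ultimately show ?thesis
    by (auto intro!: derivative_eq_intros c simp: algebra_simps)
qed

lemma smooth_on_curve_combination:
  fixes \<alpha> \<beta> \<gamma>1 \<gamma>2 \<kappa> :: "'b::real_normed_vector"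
  assumes U: "open U"
  shows "smooth_on U (\<lambda>p::real^2. a (p $ 2) *\<^sub>R \<alpha> + b (p $ 2) *\<^sub>R \<beta> + (p $ 1 *\<^sub>R \<gamma>1 + p $ 2 *\<^sub>R \<gamma>2) + \<kappa>)"
  unfolding smooth_on_def
proof
  fix k
  show "Ck_on k U (\<lambda>p::real^2. a (p $ 2) *\<^sub>R \<alpha> + b (p $ 2) *\<^sub>R \<beta> + (p $ 1 *\<^sub>R \<gamma>1 + p $ 2 *\<^sub>R \<gamma>2) + \<kappa>)"
  proof (induction k arbitrary: \<alpha> \<beta> \<gamma>1 \<gamma>2 \<kappa>)
    case 0
    have "(\<lambda>p::real^2. a (p $ 2) *\<^sub>R \<alpha> + b (p $ 2) *\<^sub>R \<beta> + (p $ 1 *\<^sub>R \<gamma>1 + p $ 2 *\<^sub>R \<gamma>2) + \<kappa>) differentiable_on U"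
      by (rule differentiable_on_openI[OF U curve_combination_has_derivative])
    then show ?case by (simp add: differentiable_imp_continuous_on)
  next
    case (Suc k)
    have d: "frechet_derivative (\<lambda>p::real^2. a (p $ 2) *\<^sub>R \<alpha> + b (p $ 2) *\<^sub>R \<beta> + (p $ 1 *\<^sub>R \<gamma>1 + p $ 2 *\<^sub>R \<gamma>2) + \<kappa>) (at p) w
       = a (p $ 2) *\<^sub>R (w $ 2 *\<^sub>R \<beta>) + b (p $ 2) *\<^sub>R ((\<delta> * w $ 2) *\<^sub>R \<alpha>) + (p $ 1 *\<^sub>R 0 + p $ 2 *\<^sub>R 0)
      + (w $ 1 *\<^sub>R \<gamma>1 + w $ 2 *\<^sub>R \<gamma>2)" for p w
      using fun_cong[OF frechet_derivative_at[OF curve_combination_has_derivative[of \<alpha> \<beta> \<gamma>1 \<gamma>2 \<kappa> p]], of w]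
      by simp
    show ?case
      unfolding Ck_on.simps d
      using Suc.IH differentiable_on_openI[OF U curve_combination_has_derivative] by blast
  qed
qed

lemma F_combination:
  "F = (\<lambda>p. a (p $ 2) *\<^sub>R axis 1 1 + b (p $ 2) *\<^sub>R axis 2 1
      + (p $ 1 *\<^sub>R axis 3 1 + p $ 2 *\<^sub>R ((- \<epsilon> * \<tau>) *\<^sub>R axis 3 1)) + 0)"
  by (rule ext) (simp add: F_def vec_eq_iff forall_3 axis_def)

lemma N_F_combination:
  "N \<circ> F = (\<lambda>p. a (p $ 2) *\<^sub>R axis 1 1 + b (p $ 2) *\<^sub>R axis 2 1 + (p $ 1 *\<^sub>R 0 + p $ 2 *\<^sub>R 0) + 0)"
  by (rule ext) (simp add: N_def F_def vec_eq_iff forall_3 axis_def)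

lemma smooth_F: "open U \<Longrightarrow> smooth_on U F"
  unfolding F_combination by (rule smooth_on_curve_combination)

lemma smooth_N_F: "open U \<Longrightarrow> smooth_on U (N \<circ> F)"
  unfolding N_F_combination by (rule smooth_on_curve_combination)

lemma continuous_F: "continuous_on U F"
  using smooth_on_continuous_on[OF smooth_F[OF open_UNIV]] continuous_on_subset by blast

lemma frechet_derivative_F:
  "frechet_derivative F (at p) v = vector [\<delta> * b (p $ 2) * v $ 2, a (p $ 2) * v $ 2, v $ 1 - \<epsilon> * \<tau> * v $ 2]"
proof -
  have "frechet_derivative F (at p) v = a (p $ 2) *\<^sub>R (v $ 2 *\<^sub>R axis 2 1) + b (p $ 2) *\<^sub>R ((\<delta> * v $ 2) *\<^sub>R axis 1 1)
      + (v $ 1 *\<^sub>R axis 3 1 + v $ 2 *\<^sub>R ((- \<epsilon> * \<tau>) *\<^sub>R axis 3 1))"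
    unfolding F_combination
    by (rule fun_cong[OF frechet_derivative_at[OF curve_combination_has_derivative], symmetric])
  then show ?thesis by (simp add: vec_eq_iff forall_3 axis_def)
qed

lemma heis_form_F: "heis_form \<tau> (F p) (frechet_derivative F (at p) v) = v $ 1 - 2 * \<epsilon> * \<tau> * v $ 2"
proof -
  have "heis_form \<tau> (F p) (frechet_derivative F (at p) v)
      = v $ 1 - \<epsilon> * \<tau> * v $ 2 - \<tau> * v $ 2 * (a (p $ 2) * a (p $ 2) - \<delta> * (b (p $ 2) * b (p $ 2)))"
    by (simp add: heis_form_def frechet_derivative_F F_def algebra_simps)
  then show ?thesis unfolding unit by (simp add: algebra_simps)
qed

lemma induced_metric_F:
  "induced_metric (heis \<tau> \<delta>) F p v w = - \<delta> * \<epsilon> * (v $ 2 * w $ 2)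
     + \<delta> * ((v $ 1 - 2 * \<epsilon> * \<tau> * v $ 2) * (w $ 1 - 2 * \<epsilon> * \<tau> * w $ 2))"
proof -
  have "\<delta> * \<delta> = 1" using \<delta> by auto
  then have "\<delta> * b (p $ 2) * v $ 2 * (\<delta> * b (p $ 2) * w $ 2) - \<delta> * (a (p $ 2) * v $ 2 * (a (p $ 2) * w $ 2))
      = - \<delta> * (a (p $ 2) * a (p $ 2) - \<delta> * (b (p $ 2) * b (p $ 2))) * (v $ 2 * w $ 2)"
    by (simp add: algebra_simps)
  then show ?thesis
    unfolding unit induced_metric_def heis_def heis_form_F by (simp add: frechet_derivative_F)
qed

lemma inj_frechet_derivative_F: "inj (frechet_derivative F (at p))"
proof -
  have "linear (frechet_derivative F (at p))"
    by (rule linear_frechet_derivative[OF smooth_on_differentiable[OF smooth_F[OF open_UNIV] open_UNIV UNIV_I]])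
  moreover have "v = 0" if "frechet_derivative F (at p) v = 0" for v
  proof -
    have z: "\<delta> * b (p $ 2) * v $ 2 = 0" "a (p $ 2) * v $ 2 = 0" "v $ 1 - \<epsilon> * \<tau> * v $ 2 = 0"
      using that unfolding frechet_derivative_F by (simp_all add: vec_eq_iff forall_3)
    have "\<epsilon> * v $ 2 = a (p $ 2) * (a (p $ 2) * v $ 2) - b (p $ 2) * (\<delta> * b (p $ 2) * v $ 2)"
      unfolding unit[of "p $ 2", symmetric] by (simp add: algebra_simps)
    then have "v $ 2 = 0" unfolding z using \<epsilon> by auto
    then show ?thesis using z(3) by (simp add: vec_eq_iff forall_2)
  qed
  ultimately show ?thesis using linear_injective_0 by blast
qed

lemma heis_form_N: "heis_form \<tau> q (N q) = 0"
  by (simp add: heis_form_def N_def)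

lemma F_shift: "F (p + h) = F (q + h)" if "F p = F q"
proof -
  have e: "a (p $ 2) = a (q $ 2)" "b (p $ 2) = b (q $ 2)"
    "p $ 1 - \<epsilon> * \<tau> * p $ 2 = q $ 1 - \<epsilon> * \<tau> * q $ 2"
    using that by (simp_all add: F_def vec_eq_iff forall_3)
  show ?thesis
    using shift[OF e(1,2), of "h $ 2"] e(3) by (simp add: F_def vec_eq_iff forall_3 algebra_simps)
qed

lemma F_section:
  obtains r T G where "r > 0" "open T" "continuous_on T G"
    "\<And>p. \<bar>p $ 2 - p0 $ 2\<bar> < r \<Longrightarrow> F p \<in> T \<and> G (F p) = p"
    "\<And>p. F p \<in> T \<Longrightarrow> F (G (F p)) = F p"
proof -
  obtain r T g where r: "r > 0" and T: "open T" and g: "continuous_on T g"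
    and loc: "\<And>v. \<bar>v - p0 $ 2\<bar> < r \<Longrightarrow> (a v, b v) \<in> T \<and> g (a v, b v) = v"
    and sec: "\<And>v. (a v, b v) \<in> T \<Longrightarrow> a (g (a v, b v)) = a v \<and> b (g (a v, b v)) = b v"
    using local_section[of "p0 $ 2"] by blast
  define T' where "T' = {q::real^3. (q $ 1, q $ 2) \<in> T}"
  define G :: "real^3 \<Rightarrow> real^2" where
    "G q = (q $ 3 + \<epsilon> * \<tau> * g (q $ 1, q $ 2)) *\<^sub>R axis 1 1 + g (q $ 1, q $ 2) *\<^sub>R axis 2 1" for q
  have "continuous_on UNIV (\<lambda>q::real^3. (q $ 1, q $ 2))" by (intro continuous_intros)
  then have T': "open T'" using open_vimage[OF T] by (simp add: T'_def vimage_def)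
  have cg: "continuous_on T' (\<lambda>q. g (q $ 1, q $ 2))"
    by (rule continuous_on_compose2[OF g]) (auto simp: T'_def intro!: continuous_intros)
  have "continuous_on T' G" unfolding G_def using cg by (intro continuous_intros)
  moreover have "F p \<in> T' \<and> G (F p) = p" if "\<bar>p $ 2 - p0 $ 2\<bar> < r" for p
    using loc[OF that] by (simp add: T'_def G_def F_def vec_eq_iff forall_2 axis_def)
  moreover have "F (G (F p)) = F p" if "F p \<in> T'" for p
    using sec[of "p $ 2"] that by (simp add: T'_def G_def F_def vec_eq_iff forall_3 axis_def)
  ultimately show ?thesis using that[OF r T', of G] by blast
qed

text \<open>An injective restriction of a parametrization has to be a homeomorphism onto an open subset. Near
\<open>F p0\<close> the points of the cylinder that \<open>G\<close> takes into \<open>W\<close> belong to the image of \<open>W\<close>.\<close>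

lemma F_image_open:
  assumes W: "open W"
  shows "openin (top_of_set (range F)) (F ` W)"
proof (subst openin_subopen, intro ballI)
  fix y assume "y \<in> F ` W"
  then obtain p0 where p0: "p0 \<in> W" "y = F p0" by blast
  obtain r T G where r: "r > 0" and T: "open T" and G: "continuous_on T G"
    and loc: "\<And>p. \<bar>p $ 2 - p0 $ 2\<bar> < r \<Longrightarrow> F p \<in> T \<and> G (F p) = p"
    and sec: "\<And>p. F p \<in> T \<Longrightarrow> F (G (F p)) = F p"
    using F_section[of p0] by metis
  have "open (T \<inter> G -` W)" using G T W by (rule continuous_open_preimage)
  then have "openin (top_of_set (range F)) (range F \<inter> (T \<inter> G -` W))" by (rule openin_open_Int)
  moreover have "y \<in> range F \<inter> (T \<inter> G -` W)" using loc[of p0] r p0 by simp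
  moreover have "range F \<inter> (T \<inter> G -` W) \<subseteq> F ` W"
  proof
    fix q assume "q \<in> range F \<inter> (T \<inter> G -` W)"
    then obtain p where "q = F p" "F p \<in> T" "G (F p) \<in> W" by auto
    then show "q \<in> F ` W" using sec[of p] by (metis imageI)
  qed
  ultimately show "\<exists>T. openin (top_of_set (range F)) T \<and> y \<in> T \<and> T \<subseteq> F ` W" by blast
qed

lemma F_preimage_open:
  assumes "openin (top_of_set (range F)) S"
  shows "open (F -` S)"
proof -
  obtain T where T: "open T" "S = range F \<inter> T" using assms openin_open by metis
  have "open (F -` T)" using continuous_F[of UNIV] T(1) by (simp add: open_vimage)
  moreover have "F -` S = F -` T" using T(2) by auto
  ultimately show ?thesis by simp
qed

text \<open>If \<open>F p0 = F q0\<close> then translation by \<open>q0 - p0\<close> does not change \<open>F\<close>; by injectivity on \<open>V\<close> the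
transition map coincides with it near \<open>p0\<close>.\<close>

lemma smooth_transition:
  assumes U: "open U" and V: "open V" and inj: "inj_on F V"
  shows "smooth_on {p \<in> U. F p \<in> F ` V} (inv_into V F \<circ> F)"
proof (rule smooth_on_constant_derivative)
  have "{p \<in> U. F p \<in> F ` V} = U \<inter> F -` (F ` V)" by auto
  then show "open {p \<in> U. F p \<in> F ` V}" using U F_preimage_open[OF F_image_open[OF V]] by auto
  fix p0 assume "p0 \<in> {p \<in> U. F p \<in> F ` V}"
  then obtain q0 where q0: "q0 \<in> V" "F p0 = F q0" by auto
  have d: "((\<lambda>p. p + (q0 - p0)) has_derivative (\<lambda>v. v)) (at p0)"
    by (auto intro!: derivative_eq_intros)
  show "((inv_into V F \<circ> F) has_derivative (\<lambda>v. v)) (at p0)"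
  proof (rule has_derivative_transform_within_open[OF d])
    show "open ((\<lambda>p. p + (q0 - p0)) -` V)"
      by (rule open_vimage[OF V]) (intro continuous_intros)
    show "p0 \<in> (\<lambda>p. p + (q0 - p0)) -` V" using q0(1) by simp
    fix p assume p: "p \<in> (\<lambda>p. p + (q0 - p0)) -` V"
    have "F p = F (p + (q0 - p0))" using F_shift[OF q0(2), of "p - p0"] by (simp add: algebra_simps)
    then show "p + (q0 - p0) = (inv_into V F \<circ> F) p"
      using inv_into_f_f[OF inj] p by simp
  qed
qed

lemma smooth_surface_F:
  assumes S: "openin (top_of_set (range F)) S"
  shows "smooth_surface (top_of_set S) (restriction_atlas F S)"
  unfolding smooth_surface_def
proof (intro conjI)
  show "Hausdorff_space (top_of_set S)" by (simp add: Hausdorff_space_subtopology)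
  show "second_countable (top_of_set S)" by (simp add: second_countable_subtopology second_countable_euclidean)
  have SF: "S \<subseteq> range F" using openin_subset[OF S] by simp
  have im: "openin (top_of_set S) (F ` B)" if "open B" "F ` B \<subseteq> S" for B
    using openin_subset_trans[OF F_image_open[OF that(1)] that(2)] SF by blast
  have emb: "embedding_map (top_of_set W) (top_of_set S) F"
    if W: "open W" "inj_on F W" "F ` W \<subseteq> S" for W
  proof (rule injective_open_imp_embedding_map)
    show "continuous_map (top_of_set W) (top_of_set S) F"
      using W(3) continuous_F by (auto simp: continuous_map_in_subtopology)
    show "open_map (top_of_set W) (top_of_set S) F"
      unfolding open_map_def
    proof (intro allI impI)
      fix B assume "openin (top_of_set W) B"
      then have "open B" "B \<subseteq> W" using W(1) openin_open_eq by blast+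
      then show "openin (top_of_set S) (F ` B)" using W(3) by (intro im) auto
    qed
  qed (use W in simp)
  show "\<forall>(U, \<phi>)\<in>restriction_atlas F S. open U \<and> embedding_map (top_of_set U) (top_of_set S) \<phi>
      \<and> openin (top_of_set S) (\<phi> ` U)"
    using emb im by (auto simp: restriction_atlas_def)
  show "(\<Union>(U, \<phi>)\<in>restriction_atlas F S. \<phi> ` U) = topspace (top_of_set S)"
  proof (intro equalityI subsetI)
    fix x assume "x \<in> topspace (top_of_set S)"
    then have xS: "x \<in> S" by simp
    then obtain p0 where p0: "x = F p0" using SF by blast
    obtain r T G where r: "r > 0" and loc: "\<And>p. \<bar>p $ 2 - p0 $ 2\<bar> < r \<Longrightarrow> F p \<in> T \<and> G (F p) = p"
      using F_section[of p0] by metis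
    define W where "W = F -` S \<inter> ball p0 r"
    have "inj_on F W"
    proof (rule inj_on_inverseI[of _ G])
      fix p assume "p \<in> W"
      then have "norm (p - p0) < r" by (simp add: W_def dist_norm norm_minus_commute)
      then have "\<bar>p $ 2 - p0 $ 2\<bar> < r" using component_le_norm_cart[of "p - p0" 2] by simp
      then show "G (F p) = p" using loc by blast
    qed
    moreover have "open W" using F_preimage_open[OF S] by (simp add: W_def open_Int)
    ultimately have "(W, F) \<in> restriction_atlas F S" by (auto simp: restriction_atlas_def W_def)
    moreover have "p0 \<in> W" using r xS p0 by (simp add: W_def)
    ultimately show "x \<in> (\<Union>(U, \<phi>)\<in>restriction_atlas F S. \<phi> ` U)" using p0 by blast
  qed (auto simp: restriction_atlas_def)
  show "\<forall>(U, \<phi>)\<in>restriction_atlas F S. \<forall>(V, \<psi>)\<in>restriction_atlas F S.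
      smooth_on {p \<in> U. \<phi> p \<in> \<psi> ` V} (inv_into V \<psi> \<circ> \<phi>)"
    using smooth_transition by (auto simp: restriction_atlas_def)
qed

lemma immersed_surface_F:
  assumes S: "openin (top_of_set (range F)) S"
  shows "immersed_surface (heis \<tau> \<delta>) \<epsilon> (top_of_set S) (restriction_atlas F S) id N"
proof -
  have "S \<subseteq> range F" using openin_subset[OF S] by simp
  then have unitN: "heis \<tau> \<delta> x (N x) (N x) = \<epsilon>" if x: "x \<in> S" for x
  proof -
    obtain p where "x = F p" using \<open>S \<subseteq> range F\<close> x by blast
    then show ?thesis using unit[of "p $ 2"] by (simp add: heis_def heis_form_N) (simp add: N_def F_def)
  qed
  have nondeg: "v = 0" if v: "\<And>w. induced_metric (heis \<tau> \<delta>) F p v w = 0" for p v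
  proof -
    have 1: "v $ 1 - 2 * \<epsilon> * \<tau> * v $ 2 = 0"
      using v[of "axis 1 1"] \<delta> by (auto simp: induced_metric_F axis_def)
    have "v $ 2 = 0"
      using v[of "axis 2 1"] \<delta> \<epsilon> unfolding induced_metric_F 1 by (auto simp: axis_def)
    then show ?thesis using 1 by (simp add: vec_eq_iff forall_2)
  qed
  have orth: "heis \<tau> \<delta> (F p) (N (F p)) (frechet_derivative F (at p) v) = 0" for p v
    by (simp add: heis_def heis_form_N) (simp add: N_def F_def frechet_derivative_F)
  show ?thesis
    unfolding immersed_surface_def
    using smooth_surface_F[OF S] \<epsilon> unitN nondeg orth inj_frechet_derivative_F smooth_F smooth_N_F
    by (auto simp: restriction_atlas_def)
qed

text \<open>The frame components of the normal are the coordinates \<open>x\<close> and \<open>y\<close> of the surface, so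
\<open>vertical_mean_curvature\<close> reads \<open>dx \<and> \<zeta> = - 2 H dx \<and> \<zeta>\<close> and \<open>dy \<and> \<zeta> = - 2 H dy \<and> \<zeta>\<close>.\<close>

lemma mean_curvature_F:
  assumes "openin (top_of_set (range F)) S" "(U, \<phi>) \<in> restriction_atlas F S" "p \<in> U"
  shows "mean_curvature (heis \<tau> \<delta>) (id \<circ> \<phi>) (N \<circ> \<phi>) p = - 1 / 2"
proof -
  have \<phi>: "\<phi> = F" using assms(2) by (auto simp: restriction_atlas_def)
  interpret helix_chart \<tau> \<delta> \<epsilon> 0 U "id \<circ> \<phi>" "N \<circ> \<phi>"
    by (rule immersed_surface_helix_chart[OF immersed_surface_F[OF assms(1)] \<delta> _ assms(2)])
       (simp add: heis_form_N)
  define H where "H = mean_curvature (heis \<tau> \<delta>) (id \<circ> \<phi>) (N \<circ> \<phi>) p"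
  have "(\<lambda>q. (N \<circ> \<phi>) q $ 1) = (\<lambda>q. (id \<circ> \<phi>) q $ 1)" "(\<lambda>q. (N \<circ> \<phi>) q $ 2) = (\<lambda>q. (id \<circ> \<phi>) q $ 2)"
    by (simp_all add: N_def)
  note eqs = vertical_mean_curvature[OF refl assms(3), unfolded this, folded H_def]
  have "(1 + 2 * H) * (dx 1 p * zeta 2 p - dx 2 p * zeta 1 p) = 0"
    "(1 + 2 * H) * (dy 1 p * zeta 2 p - dy 2 p * zeta 1 p) = 0"
    using eqs by (simp_all add: algebra_simps)
  then have "1 + 2 * H = 0"
    using immersion[OF assms(3)] vertical_dx_dy[OF refl assms(3)] by auto
  then show ?thesis unfolding H_def[symmetric] by simp
qed

theorem open_subsets_cylinder: "open_subsets_flat_proper_CMC (heis \<tau> \<delta>) \<epsilon> F"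
  unfolding open_subsets_flat_proper_CMC_def
proof (intro allI impI exI conjI)
  fix S assume S: "openin (top_of_set (range F)) S"
  show im: "immersed_surface (heis \<tau> \<delta>) \<epsilon> (top_of_set S) (restriction_atlas F S) id N"
    by (rule immersed_surface_F[OF S])
  show "flat_surface (heis \<tau> \<delta>) (restriction_atlas F S) id"
    by (rule vertical_surface_flat[OF \<delta> im]) (simp add: heis_form_N)
  show "proper_CMC_surface (heis \<tau> \<delta>) (restriction_atlas F S) id N"
    unfolding proper_CMC_surface_def
    by (rule exI[of _ "- 1 / 2"]) (use mean_curvature_F[OF S] in auto)
qed

end
end

text \<open>The angle from the point with parameter \<open>v0\<close> is the arctangent of the quotient of its sine and cosine,
which are linear in the point; this is the local parameter on the half plane where the cosine is
positive.\<close>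

lemma vertical_cylinder_circle: "vertical_cylinder (-1) 1 (\<lambda>v. - cos v) (\<lambda>v. - sin v)"
proof
  fix v w h v0 :: real
  show "((\<lambda>v. - cos v) has_real_derivative - 1 * - sin v) (at v)"
    "((\<lambda>v. - sin v) has_real_derivative - cos v) (at v)"
    by (auto intro!: derivative_eq_intros)
  show "- cos v * - cos v - - 1 * (- sin v * - sin v) = 1"
    using sin_cos_squared_add[of v] by (simp add: power2_eq_square)
  show "- cos (v + h) = - cos (w + h) \<and> - sin (v + h) = - sin (w + h)"
    if "- cos v = - cos w" "- sin v = - sin w"
    using that by (simp add: cos_add sin_add)
  \<comment> \<open>cosine and sine of the angle from the point with parameter \<open>v0\<close>, in terms of the point \<open>x\<close>\<close>
  define C where "C x = - (fst x * cos v0 + snd x * sin v0)" for x :: "real \<times> real"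
  define S where "S x = fst x * sin v0 - snd x * cos v0" for x :: "real \<times> real"
  define g where "g x = v0 + arctan (S x / C x)" for x
  define T where "T = {x. 0 < C x}"
  have C: "C (- cos v, - sin v) = cos (v - v0)" and S: "S (- cos v, - sin v) = sin (v - v0)" for v
    by (simp_all add: C_def S_def cos_diff sin_diff)
  have "open T"
    unfolding T_def C_def by (intro open_Collect_less continuous_intros)
  moreover have "continuous_on T g"
    unfolding g_def T_def by (auto simp: C_def S_def intro!: continuous_intros)
  moreover have "(- cos v, - sin v) \<in> T \<and> g (- cos v, - sin v) = v" if "\<bar>v - v0\<bar> < pi / 2" for v
  proof -
    have b: "- (pi / 2) < v - v0" "v - v0 < pi / 2" using that by linarith+
    have "cos (v - v0) > 0" using b by (rule cos_gt_zero_pi)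
    moreover have "arctan (sin (v - v0) / cos (v - v0)) = v - v0"
      using arctan_tan[OF b] by (simp add: tan_def)
    ultimately show ?thesis by (simp add: T_def g_def C S)
  qed
  moreover have "- cos (g (- cos v, - sin v)) = - cos v \<and> - sin (g (- cos v, - sin v)) = - sin v"
    if "(- cos v, - sin v) \<in> T" for v
  proof -
    define t where "t = v - v0"
    have c: "cos t > 0" using that by (simp add: T_def C t_def)
    have "1 + (sin t / cos t)\<^sup>2 = 1 / (cos t)\<^sup>2"
      using c sin_cos_squared_add[of t] by (simp add: field_simps)
    then have "sqrt (1 + (sin t / cos t)\<^sup>2) = 1 / cos t" using c by (simp add: real_sqrt_divide)
    then have "cos (arctan (sin t / cos t)) = cos t" "sin (arctan (sin t / cos t)) = sin t"
      using c by (simp_all add: cos_arctan sin_arctan)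
    moreover have "g (- cos v, - sin v) = v0 + arctan (sin t / cos t)" by (simp add: g_def C S t_def)
    moreover have "v = v0 + t" by (simp add: t_def)
    ultimately show ?thesis by (simp add: cos_add sin_add)
  qed
  ultimately show "\<exists>r>0. \<exists>T g. open T \<and> continuous_on T g
      \<and> (\<forall>v. \<bar>v - v0\<bar> < r \<longrightarrow> (- cos v, - sin v) \<in> T \<and> g (- cos v, - sin v) = v)
      \<and> (\<forall>v. (- cos v, - sin v) \<in> T \<longrightarrow> - cos (g (- cos v, - sin v)) = - cos v
          \<and> - sin (g (- cos v, - sin v)) = - sin v)"
    by (intro exI[of _ "pi / 2"] conjI exI[of _ T] exI[of _ g]) auto
qed auto

lemma arsinh_sinh: "arsinh (sinh v) = (v::real)"
  using sinh_arsinh_real[of "sinh v"] by (simp only: sinh_real_eq_iff)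

lemma vertical_cylinder_timelike_hyperbola: "vertical_cylinder 1 1 cosh sinh"
proof
  fix v w h v0 :: real
  show "(cosh has_real_derivative 1 * sinh v) (at v)" "(sinh has_real_derivative cosh v) (at v)"
    by (auto intro!: derivative_eq_intros)
  show "cosh v * cosh v - 1 * (sinh v * sinh v) = 1"
    using cosh_square_eq[of v] by (simp add: power2_eq_square)
  show "cosh (v + h) = cosh (w + h) \<and> sinh (v + h) = sinh (w + h)" if "sinh v = sinh w"
    using that by simp
  have "continuous_on UNIV (\<lambda>x :: real \<times> real. arsinh (snd x))"
    by (intro continuous_on_compose2[OF continuous_on_arsinh[of UNIV]] continuous_intros) simp
  then show "\<exists>r>0. \<exists>T g. open T \<and> continuous_on T g
      \<and> (\<forall>v. \<bar>v - v0\<bar> < r \<longrightarrow> (cosh v, sinh v) \<in> T \<and> g (cosh v, sinh v) = v)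
      \<and> (\<forall>v. (cosh v, sinh v) \<in> T \<longrightarrow> cosh (g (cosh v, sinh v)) = cosh v
          \<and> sinh (g (cosh v, sinh v)) = sinh v)"
    by (intro exI[of _ 1] conjI exI[of _ UNIV] exI[of _ "\<lambda>x. arsinh (snd x)"])
       (auto simp: arsinh_sinh)
qed auto

lemma vertical_cylinder_spacelike_hyperbola: "vertical_cylinder 1 (-1) sinh cosh"
proof
  fix v w h v0 :: real
  show "(sinh has_real_derivative 1 * cosh v) (at v)" "(cosh has_real_derivative sinh v) (at v)"
    by (auto intro!: derivative_eq_intros)
  show "sinh v * sinh v - 1 * (cosh v * cosh v) = - 1"
    using cosh_square_eq[of v] by (simp add: power2_eq_square)
  show "sinh (v + h) = sinh (w + h) \<and> cosh (v + h) = cosh (w + h)" if "sinh v = sinh w"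
    using that by simp
  have "continuous_on UNIV (\<lambda>x :: real \<times> real. arsinh (fst x))"
    by (intro continuous_on_compose2[OF continuous_on_arsinh[of UNIV]] continuous_intros) simp
  then show "\<exists>r>0. \<exists>T g. open T \<and> continuous_on T g
      \<and> (\<forall>v. \<bar>v - v0\<bar> < r \<longrightarrow> (sinh v, cosh v) \<in> T \<and> g (sinh v, cosh v) = v)
      \<and> (\<forall>v. (sinh v, cosh v) \<in> T \<longrightarrow> sinh (g (sinh v, cosh v)) = sinh v
          \<and> cosh (g (sinh v, cosh v)) = cosh v)"
    by (intro exI[of _ 1] conjI exI[of _ UNIV] exI[of _ "\<lambda>x. arsinh (fst x)"])
       (auto simp: arsinh_sinh)
qed auto

section \<open>The classification theorem\<close>

lemma hyperbola_parameter:
  fixes x y :: real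
  assumes "x * x - y * y = 1" "0 < x"
  shows "x = cosh (arsinh y)" "y = sinh (arsinh y)"
proof -
  have "y\<^sup>2 + 1 = x\<^sup>2" using assms(1) by (simp add: power2_eq_square)
  then show "x = cosh (arsinh y)" using assms(2) by (simp add: cosh_arsinh_real)
qed simp

theorem theorem4p5:
  fixes \<tau> \<delta> :: real
  assumes "\<tau> \<noteq> 0" and "\<delta> \<in> {1, -1}"
  shows "(\<forall>(\<epsilon>::real) (M :: 'm topology) A f N.
      immersed_surface (heis \<tau> \<delta>) \<epsilon> M A f N \<and> connected_space M \<and> topspace M \<noteq> {} \<and>
      constant_angle_surface (heis \<tau> \<delta>) \<epsilon> M f N \<and>
      minimal_surface (heis \<tau> \<delta>) A f N \<longrightarrow>
        flat_surface (heis \<tau> \<delta>) A f \<and>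
        (\<delta> = -1 \<longrightarrow> \<epsilon> = 1 \<and>
           (\<exists>\<phi>\<^sub>0. open_part_up_to_isometry (heis \<tau> \<delta>) M f
              (\<lambda>p. vector [sin \<phi>\<^sub>0 * p $ 2, - cos \<phi>\<^sub>0 * p $ 2, p $ 1]))) \<and>
        (\<delta> = 1 \<longrightarrow>
           (\<epsilon> = 1 \<longrightarrow>
              (\<exists>\<phi>\<^sub>0. open_part_up_to_isometry (heis \<tau> \<delta>) M f
                 (\<lambda>p. vector [sinh \<phi>\<^sub>0 * p $ 2, cosh \<phi>\<^sub>0 * p $ 2, p $ 1]))) \<and>
           (\<epsilon> = -1 \<longrightarrow>
              (\<exists>\<phi>\<^sub>0. open_part_up_to_isometry (heis \<tau> \<delta>) M f
                 (\<lambda>p. vector [cosh \<phi>\<^sub>0 * p $ 2, sinh \<phi>\<^sub>0 * p $ 2, p $ 1])))))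
    \<and>
     (\<delta> = -1 \<longrightarrow>
        open_subsets_flat_proper_CMC (heis \<tau> \<delta>) 1
          (\<lambda>p. vector [- cos (p $ 2), - sin (p $ 2), p $ 1 - \<tau> * p $ 2]))
    \<and>
     (\<delta> = 1 \<longrightarrow>
        open_subsets_flat_proper_CMC (heis \<tau> \<delta>) 1
          (\<lambda>p. vector [cosh (p $ 2), sinh (p $ 2), p $ 1 - \<tau> * p $ 2]) \<and>
        open_subsets_flat_proper_CMC (heis \<tau> \<delta>) (-1)
          (\<lambda>p. vector [sinh (p $ 2), cosh (p $ 2), p $ 1 + \<tau> * p $ 2]))"
proof (intro conjI impI allI)
  fix \<epsilon> and M :: "'m topology" and A f N
  assume *: "immersed_surface (heis \<tau> \<delta>) \<epsilon> M A f N \<and> connected_space M \<and> topspace M \<noteq> {} \<and>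
      constant_angle_surface (heis \<tau> \<delta>) \<epsilon> M f N \<and> minimal_surface (heis \<tau> \<delta>) A f N"
  then have im: "immersed_surface (heis \<tau> \<delta>) \<epsilon> M A f N" by blast
  then have \<epsilon>: "\<epsilon> \<in> {1, -1}" by (simp add: immersed_surface_def)
  have con: "connected_space M" and ne: "topspace M \<noteq> {}"
    and ca: "constant_angle_surface (heis \<tau> \<delta>) \<epsilon> M f N" and min: "minimal_surface (heis \<tau> \<delta>) A f N"
    using * by blast+
  note classification = minimal_constant_angle_classification[OF assms im con ne ca min]
  obtain n1 n2 where n: "n1 * n1 - \<delta> * (n2 * n2) = \<epsilon>"
    and plane: "\<And>s. s \<in> {1, -1} \<Longrightarrow> open_part_up_to_isometry (heis \<tau> \<delta>) M f
      (\<lambda>p. vector [\<delta> * (s * n2) * p $ 2, (s * n1) * p $ 2, p $ 1])"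
    using classification(2) by blast
  show "flat_surface (heis \<tau> \<delta>) A f" by (rule classification(1))
  show "\<epsilon> = 1" if "\<delta> = -1"
  proof -
    have "\<epsilon> = n1 * n1 + n2 * n2" using n that by simp
    then show ?thesis using \<epsilon> sum_squares_ge_zero[of n1 n2] by auto
  qed
  show "\<exists>\<phi>\<^sub>0. open_part_up_to_isometry (heis \<tau> \<delta>) M f
      (\<lambda>p. vector [sin \<phi>\<^sub>0 * p $ 2, - cos \<phi>\<^sub>0 * p $ 2, p $ 1])" if \<delta>: "\<delta> = -1"
  proof -
    have "n1 * n1 + n2 * n2 = 1"
      using n \<delta> \<epsilon> sum_squares_ge_zero[of n1 n2] by auto
    then have "(- n1)\<^sup>2 + (- n2)\<^sup>2 = 1" by (simp add: power2_eq_square)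
    then obtain t where "- n1 = cos t" "- n2 = sin t" using sincos_total_2pi by metis
    then have "n1 = - cos t" "n2 = - sin t" by linarith+
    then show ?thesis using plane[of 1] \<delta> by (intro exI[of _ t]) simp
  qed
  show "\<exists>\<phi>\<^sub>0. open_part_up_to_isometry (heis \<tau> \<delta>) M f
      (\<lambda>p. vector [sinh \<phi>\<^sub>0 * p $ 2, cosh \<phi>\<^sub>0 * p $ 2, p $ 1])" if \<delta>: "\<delta> = 1" and e: "\<epsilon> = 1"
  proof -
    \<comment> \<open>the sign puts \<open>(n1, n2)\<close> on the branch parametrized by \<open>(cosh, sinh)\<close>\<close>
    define s :: real where "s = (if n1 > 0 then 1 else -1)"
    have s: "s \<in> {1, -1}" by (simp add: s_def)
    have "n1 * n1 = 1 + n2 * n2" using n \<delta> e by simp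
    then have "n1 * n1 > 0" using zero_le_square[of n2] by linarith
    then have "n1 \<noteq> 0" by auto
    then have "s * n1 > 0" by (auto simp: s_def)
    moreover have "s * n1 * (s * n1) - s * n2 * (s * n2) = 1" using n \<delta> e s by auto
    ultimately have "s * n1 = cosh (arsinh (s * n2))" "s * n2 = sinh (arsinh (s * n2))"
      using hyperbola_parameter by blast+
    then show ?thesis using plane[OF s] \<delta> by (intro exI[of _ "arsinh (s * n2)"]) simp
  qed
  show "\<exists>\<phi>\<^sub>0. open_part_up_to_isometry (heis \<tau> \<delta>) M f
      (\<lambda>p. vector [cosh \<phi>\<^sub>0 * p $ 2, sinh \<phi>\<^sub>0 * p $ 2, p $ 1])" if \<delta>: "\<delta> = 1" and e: "\<epsilon> = -1"
  proof -
    define s :: real where "s = (if n2 > 0 then 1 else -1)"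
    have s: "s \<in> {1, -1}" by (simp add: s_def)
    have "n2 * n2 = 1 + n1 * n1" using n \<delta> e by simp
    then have "n2 * n2 > 0" using zero_le_square[of n1] by linarith
    then have "n2 \<noteq> 0" by auto
    then have "s * n2 > 0" by (auto simp: s_def)
    moreover have "s * n2 * (s * n2) - s * n1 * (s * n1) = 1" using n \<delta> e s by auto
    ultimately have "s * n2 = cosh (arsinh (s * n1))" "s * n1 = sinh (arsinh (s * n1))"
      using hyperbola_parameter by blast+
    then show ?thesis using plane[OF s] \<delta> by (intro exI[of _ "arsinh (s * n1)"]) simp
  qed
next
  assume "\<delta> = -1"
  then show "open_subsets_flat_proper_CMC (heis \<tau> \<delta>) 1
      (\<lambda>p. vector [- cos (p $ 2), - sin (p $ 2), p $ 1 - \<tau> * p $ 2])"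
    using vertical_cylinder.open_subsets_cylinder[OF vertical_cylinder_circle, of \<tau>]
    by (simp add: cylinder_def[abs_def])
next
  assume "\<delta> = 1"
  then show "open_subsets_flat_proper_CMC (heis \<tau> \<delta>) 1
      (\<lambda>p. vector [cosh (p $ 2), sinh (p $ 2), p $ 1 - \<tau> * p $ 2])"
    using vertical_cylinder.open_subsets_cylinder[OF vertical_cylinder_timelike_hyperbola, of \<tau>]
    by (simp add: cylinder_def[abs_def])
next
  assume "\<delta> = 1"
  then show "open_subsets_flat_proper_CMC (heis \<tau> \<delta>) (-1)
      (\<lambda>p. vector [sinh (p $ 2), cosh (p $ 2), p $ 1 + \<tau> * p $ 2])"
    using vertical_cylinder.open_subsets_cylinder[OF vertical_cylinder_spacelike_hyperbola, of \<tau>]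
    by (simp add: cylinder_def[abs_def])
qed

end
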